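(* Let $(M,F)$ be a Finsler surface with nonflat geodesic spray $S$, and let $(X_1,X_2,X_3,X_4)=(H,S,V,\mathcal{C})$ be its Berwald frame, with dual coframe $\{\eta^i,\ 1\le i\le 4\}$. The Berwald connection $1$-forms $\omega^a_b(X)=\eta^a(D_XX_b)$ are given by the matrix $$[\omega_b^a]=\begin{bmatrix} \mathcal{J}\,\eta^1-\mathcal{I}\,\eta^3+\eta^4 & -\eta^3 & 0 & 0\\ \eta^3 & \eta^4 & 0 & 0\\ 0 & 0 & \mathcal{J}\,\eta^1-\mathcal{I}\,\eta^3+\eta^4 & -\eta^3\\ 0 & 0 & \eta^3 & \eta^4 \end{bmatrix},$$ where the lower index $b$ labels rows and the upper index $a$ labels columns.
   Context: $M$ is a $2$-dimensional smooth manifold, $\mathcal{T}M$ its tangent bundle with the zero section removed, with induced coordinates $(x^i,y^i)$; $J=\frac{\partial}{\partial y^i}\otimes dx^i$ is the almost-tangent structure and $\mathcal{C}=y^i\frac{\partial}{\partial y^i}$ the Liouville vector field. $F:TM\to\mathbb{R}$ is a Finsler function: smooth and positive on $\mathcal{T}M$, zero exactly on the zero section, positively $1$-homogeneous in $y$, with $g_{ij}=\frac12\frac{\partial^2F^2}{\partial y^i\partial y^j}$ of maximal rank on $\mathcal{T}M$. $S=y^i\frac{\partial}{\partial x^i}-2G^i\frac{\partial}{\partial y^i}$ is its geodesic spray, $h=\frac12(Id+[J,S])$ and $v=\frac12(Id-[J,S])$ (Frölicher–Nijenhuis bracket) are the horizontal and vertical projectors. With $G^i_j=\partial G^i/\partial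 y^j$, the Jacobi endomorphism is $\Phi=\big(2\frac{\partial G^i}{\partial x^j}-S(G^i_j)-G^i_kG^k_j\big)\frac{\partial}{\partial y^i}\otimes dx^j$; in dimension $2$ one has $\Phi=K(F^2J-F\,d_JF\otimes\mathcal{C})$, where $K\in C^\infty(\mathcal{T}M)$ is the flag curvature; the Ricci scalar is $\rho=KF^2$. $S$ is nonflat: $K$ vanishes nowhere on $\mathcal{T}M$. Berwald frame: $H$ is a horizontal vector field on $\mathcal{T}M$ with $[\mathcal{C},H]=H$, $d_JF(H)=0$, $V:=JH$, normalized so that $[S,H]=\rho V$, $[V,S]=H$, $[H,V]=S+\mathcal{I}H+\mathcal{J}V$ with $\mathcal{J}=S(\mathcal{I})$. Here $\mathcal{I}$ is the main (Cartan) scalar and $\mathcal{J}$ the Landsberg scalar; also $[\mathcal{C},S]=S$, $[\mathcal{C},V]=0$. $(H,S,V,\mathcal{C})$ is a global frame on $\mathcal{T}M$. Berwald connection: $D_XY=v[hX,vY]+h[vX,hY]+J[vX,\theta Y]+\theta[hX,JY]$ with $\theta=h\circ[S,h]$. *)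

theory Defs
  imports "HOL-Analysis.Analysis"
begin

section \<open>Smooth maps and smooth manifolds\<close>

text \<open>\<^term>\<open>S\<close> is meant to be open in the two definitions below.\<close>

primrec Ck_on ::
  "nat \<Rightarrow> 'a::euclidean_space set \<Rightarrow> ('a \<Rightarrow> 'b::real_normed_vector) \<Rightarrow> bool" where
  "Ck_on 0 S f \<longleftrightarrow> continuous_on S f"
| "Ck_on (Suc k) S f \<longleftrightarrow>
     (\<forall>x\<in>S. f differentiable (at x)) \<and>
     (\<forall>w. Ck_on k S (\<lambda>x. frechet_derivative f (at x) w))"

definition smooth_on ::
  "'a::euclidean_space set \<Rightarrow> ('a \<Rightarrow> 'b::real_normed_vector) \<Rightarrow> bool" where
  "smooth_on S f \<longleftrightarrow> (\<forall>k. Ck_on k S f)"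

text \<open>A chart is its domain together with its coordinate map; values of the map outside the
  domain are irrelevant.\<close>

type_synonym ('p, 'e) chart = "'p set \<times> ('p \<Rightarrow> 'e)"

abbreviation cdom :: "('p, 'e) chart \<Rightarrow> 'p set" where "cdom c \<equiv> fst c"
abbreviation cmap :: "('p, 'e) chart \<Rightarrow> 'p \<Rightarrow> 'e" where "cmap c \<equiv> snd c"

definition cinv :: "('p, 'e) chart \<Rightarrow> 'e \<Rightarrow> 'p" where
  "cinv c = inv_into (cdom c) (cmap c)"

text \<open>\<open>A\<close> is an atlas making the whole type a smooth manifold modelled on \<open>'e\<close>.\<close>

definition smooth_manifold ::
  "('p::{t2_space,second_countable_topology}, 'e::euclidean_space) chart set \<Rightarrow> bool" where
  "smooth_manifold A \<longleftrightarrow>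
     (\<Union>c\<in>A. cdom c) = UNIV \<and>
     (\<forall>c\<in>A. open (cdom c) \<and> open (cmap c ` cdom c) \<and>
            homeomorphism (cdom c) (cmap c ` cdom c) (cmap c) (cinv c)) \<and>
     (\<forall>c\<in>A. \<forall>c'\<in>A. smooth_on (cmap c ` (cdom c \<inter> cdom c')) (cmap c' \<circ> cinv c))"

section \<open>Tensor calculus relative to an atlas\<close>

text \<open>In this section \<open>B\<close> is any smooth atlas of \<open>\<Union>c\<in>B. cdom c\<close>; it is used both for the base
  manifold and for its slit tangent bundle. A tangent vector at \<open>p\<close> is given by its component
  vectors in all charts around \<open>p\<close>, related by the differentials of the coordinate changes (and
  set to \<open>0\<close> for all other arguments).\<close>

definition tangent_space ::
  "('p, 'e::euclidean_space) chart set \<Rightarrow> 'p \<Rightarrow> (('p, 'e) chart \<Rightarrow> 'e) set" where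
  "tangent_space B p = {\<xi>.
     (\<forall>c\<in>B. \<forall>c'\<in>B. p \<in> cdom c \<inter> cdom c' \<longrightarrow>
        \<xi> c' = frechet_derivative (cmap c' \<circ> cinv c) (at (cmap c p)) (\<xi> c)) \<and>
     (\<forall>c. c \<notin> B \<or> p \<notin> cdom c \<longrightarrow> \<xi> c = 0)}"

type_synonym ('p, 'e) field = "'p \<Rightarrow> ('p, 'e) chart \<Rightarrow> 'e"

definition smooth_fun :: "('p, 'e::euclidean_space) chart set \<Rightarrow> ('p \<Rightarrow> real) \<Rightarrow> bool" where
  "smooth_fun B f \<longleftrightarrow> (\<forall>c\<in>B. smooth_on (cmap c ` cdom c) (f \<circ> cinv c))"

definition vector_field :: "('p, 'e::euclidean_space) chart set \<Rightarrow> ('p, 'e) field \<Rightarrow> bool" where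
  "vector_field B X \<longleftrightarrow>
     (\<forall>p\<in>(\<Union>c\<in>B. cdom c). X p \<in> tangent_space B p) \<and>
     (\<forall>c\<in>B. smooth_on (cmap c ` cdom c) (\<lambda>z. X (cinv c z) c))"

text \<open>The derivative \<open>\<xi>(f)\<close> of \<open>f\<close> along a tangent vector \<open>\<xi>\<close> at \<open>p\<close>. It does not depend on the
  chart used to compute it.\<close>

definition vderiv ::
  "('p, 'e::euclidean_space) chart set \<Rightarrow> 'p \<Rightarrow> (('p, 'e) chart \<Rightarrow> 'e) \<Rightarrow> ('p \<Rightarrow> real) \<Rightarrow> real" where
  "vderiv B p \<xi> f =
     (let c = (SOME c. c \<in> B \<and> p \<in> cdom c)
      in frechet_derivative (f \<circ> cinv c) (at (cmap c p)) (\<xi> c))"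

definition vadd :: "('p, 'e::euclidean_space) field \<Rightarrow> ('p, 'e) field \<Rightarrow> ('p, 'e) field" where
  "vadd X Y = (\<lambda>p c. X p c + Y p c)"

definition vsub :: "('p, 'e::euclidean_space) field \<Rightarrow> ('p, 'e) field \<Rightarrow> ('p, 'e) field" where
  "vsub X Y = (\<lambda>p c. X p c - Y p c)"

definition vscale :: "('p \<Rightarrow> real) \<Rightarrow> ('p, 'e::euclidean_space) field \<Rightarrow> ('p, 'e) field" where
  "vscale f X = (\<lambda>p c. f p *\<^sub>R X p c)"

text \<open>The Lie bracket, \<open>[X,Y]\<^sup>i = X(Y\<^sup>i) - Y(X\<^sup>i)\<close> in every chart.\<close>

definition lie ::
  "('p, 'e::euclidean_space) chart set \<Rightarrow> ('p, 'e) field \<Rightarrow> ('p, 'e) field \<Rightarrow> ('p, 'e) field" where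
  "lie B X Y = (\<lambda>p c.
     if c \<in> B \<and> p \<in> cdom c
     then frechet_derivative (\<lambda>z. Y (cinv c z) c) (at (cmap c p)) (X p c)
        - frechet_derivative (\<lambda>z. X (cinv c z) c) (at (cmap c p)) (Y p c)
     else 0)"

text \<open>Froelicher--Nijenhuis bracket \<open>[X,L]\<close> of a vector field \<open>X\<close> and a vector valued one-form \<open>L\<close>
  (acting on vector fields): it is the Lie derivative of \<open>L\<close> along \<open>X\<close>. By graded antisymmetry
  \<open>[L,X] = -[X,L]\<close>, i.e. \<open>[L,X](Y) = [LY,X] - L[Y,X]\<close>.\<close>

definition fn_vec_endo ::
  "('p, 'e::euclidean_space) chart set \<Rightarrow> ('p, 'e) field \<Rightarrow> (('p, 'e) field \<Rightarrow> ('p, 'e) field)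
     \<Rightarrow> ('p, 'e) field \<Rightarrow> ('p, 'e) field" where
  "fn_vec_endo B X L Y = vsub (lie B X (L Y)) (L (lie B X Y))"

definition fn_endo_vec ::
  "('p, 'e::euclidean_space) chart set \<Rightarrow> (('p, 'e) field \<Rightarrow> ('p, 'e) field) \<Rightarrow> ('p, 'e) field
     \<Rightarrow> ('p, 'e) field \<Rightarrow> ('p, 'e) field" where
  "fn_endo_vec B L X Y = vsub (lie B (L Y) X) (L (lie B Y X))"

section \<open>The slit tangent bundle of a surface\<close>

type_synonym 'm TM = "'m \<times> (('m, real^2) chart \<Rightarrow> real^2)"
type_synonym 'm TMchart = "('m TM, (real^2) \<times> (real^2)) chart"
type_synonym 'm TMfield = "('m TM, (real^2) \<times> (real^2)) field"
type_synonym 'm TTM = "'m TMchart \<Rightarrow> (real^2) \<times> (real^2)"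

definition tangent_bundle :: "('m, real^2) chart set \<Rightarrow> 'm TM set" where
  "tangent_bundle A = {(p, \<xi>). p \<in> (\<Union>c\<in>A. cdom c) \<and> \<xi> \<in> tangent_space A p}"

definition slit :: "('m, real^2) chart set \<Rightarrow> 'm TM set" where
  "slit A = {(p, \<xi>) \<in> tangent_bundle A. \<xi> \<noteq> (\<lambda>_. 0)}"

text \<open>The induced coordinates \<open>(x,y)\<close>.\<close>

definition induced_chart :: "('m, real^2) chart set \<Rightarrow> ('m, real^2) chart \<Rightarrow> 'm TMchart" where
  "induced_chart A c = ({u \<in> slit A. fst u \<in> cdom c}, \<lambda>u. (cmap c (fst u), snd u c))"

definition slit_atlas :: "('m, real^2) chart set \<Rightarrow> 'm TMchart set" where
  "slit_atlas A = induced_chart A ` A"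

text \<open>\<open>J = \<partial>/\<partial>y\<^sup>i \<otimes> dx\<^sup>i\<close> on tangent vectors and on vector fields.\<close>

definition Jvec :: "'m TTM \<Rightarrow> 'm TTM" where
  "Jvec \<xi> = (\<lambda>c. (0, fst (\<xi> c)))"

definition Jst :: "'m TMfield \<Rightarrow> 'm TMfield" where
  "Jst X = (\<lambda>u. Jvec (X u))"

definition Liouville :: "('m, real^2) chart set \<Rightarrow> 'm TMfield" where
  "Liouville A = (\<lambda>u c. if c \<in> slit_atlas A \<and> u \<in> cdom c then (0, snd (cmap c u)) else 0)"

text \<open>Partial derivatives \<open>\<partial>/\<partial>x\<^sup>j\<close> and \<open>\<partial>/\<partial>y\<^sup>j\<close> of functions of the induced coordinates.\<close>

definition dx :: "2 \<Rightarrow> ((real^2) \<times> (real^2) \<Rightarrow> 'b::real_normed_vector) \<Rightarrow> (real^2) \<times> (real^2) \<Rightarrow> 'b" where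
  "dx j f z = frechet_derivative f (at z) (axis j 1, 0)"

definition dy :: "2 \<Rightarrow> ((real^2) \<times> (real^2) \<Rightarrow> 'b::real_normed_vector) \<Rightarrow> (real^2) \<times> (real^2) \<Rightarrow> 'b" where
  "dy j f z = frechet_derivative f (at z) (0, axis j 1)"

section \<open>Finsler functions and their geodesic sprays\<close>

text \<open>\<open>F\<^sup>2\<close> in a chart.\<close>

definition sqF :: "('m TM \<Rightarrow> real) \<Rightarrow> 'm TMchart \<Rightarrow> (real^2) \<times> (real^2) \<Rightarrow> real" where
  "sqF F c z = (F (cinv c z))\<^sup>2"

definition finsler_metric ::
  "('m TM \<Rightarrow> real) \<Rightarrow> 'm TMchart \<Rightarrow> (real^2) \<times> (real^2) \<Rightarrow> real^2^2" where
  "finsler_metric F c z = (\<chi> i j. (1/2) * dy i (dy j (sqF F c)) z)"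

definition finsler_function :: "('m, real^2) chart set \<Rightarrow> ('m TM \<Rightarrow> real) \<Rightarrow> bool" where
  "finsler_function A F \<longleftrightarrow>
     smooth_fun (slit_atlas A) F \<and>
     (\<forall>u\<in>slit A. F u > 0) \<and>
     (\<forall>p\<in>(\<Union>c\<in>A. cdom c). F (p, \<lambda>_. 0) = 0) \<and>
     (\<forall>(p, \<xi>)\<in>tangent_bundle A. \<forall>t>0. F (p, \<lambda>c. t *\<^sub>R \<xi> c) = t * F (p, \<xi>)) \<and>
     (\<forall>c\<in>slit_atlas A. \<forall>u\<in>cdom c. rank (finsler_metric F c (cmap c u)) = 2)"

text \<open>\<open>S\<close> is the geodesic spray of \<open>F\<close>: the second order vector field \<open>S = y\<^sup>i\<partial>/\<partial>x\<^sup>i - 2G\<^sup>i\<partial>/\<partial>y\<^sup>i\<close>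
  solving the Euler--Lagrange equations \<open>S(\<partial>F\<^sup>2/\<partial>y\<^sup>j) = \<partial>F\<^sup>2/\<partial>x\<^sup>j\<close> (equivalently
  \<open>i\<^sub>S dd\<^sub>J F\<^sup>2 = -dF\<^sup>2\<close>). Since \<open>g\<close> has maximal rank these equations determine \<open>S\<close>.\<close>

definition geodesic_spray ::
  "('m, real^2) chart set \<Rightarrow> ('m TM \<Rightarrow> real) \<Rightarrow> 'm TMfield \<Rightarrow> bool" where
  "geodesic_spray A F S \<longleftrightarrow>
     vector_field (slit_atlas A) S \<and>
     (\<forall>c\<in>slit_atlas A. \<forall>u\<in>cdom c.
        fst (S u c) = snd (cmap c u) \<and>
        (\<forall>j. frechet_derivative (dy j (sqF F c)) (at (cmap c u)) (S u c)
              = dx j (sqF F c) (cmap c u)))"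

definition spray_coeff :: "'m TMfield \<Rightarrow> 'm TMchart \<Rightarrow> (real^2) \<times> (real^2) \<Rightarrow> real^2" where
  "spray_coeff S c z = (- (1/2)) *\<^sub>R snd (S (cinv c z) c)"

definition nonlin_conn ::
  "'m TMfield \<Rightarrow> 'm TMchart \<Rightarrow> 2 \<Rightarrow> 2 \<Rightarrow> (real^2) \<times> (real^2) \<Rightarrow> real" where
  "nonlin_conn S c i j z = dy j (\<lambda>w. spray_coeff S c w $ i) z"

definition jacobi_coeff :: "'m TMfield \<Rightarrow> 'm TMchart \<Rightarrow> 'm TM \<Rightarrow> 2 \<Rightarrow> 2 \<Rightarrow> real" where
  "jacobi_coeff S c u i j =
     2 * dx j (\<lambda>w. spray_coeff S c w $ i) (cmap c u)
     - frechet_derivative (nonlin_conn S c i j) (at (cmap c u)) (S u c)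
     - (\<Sum>k\<in>UNIV. nonlin_conn S c i k (cmap c u) * nonlin_conn S c k j (cmap c u))"

definition jacobi_endo ::
  "('m, real^2) chart set \<Rightarrow> 'm TMfield \<Rightarrow> 'm TM \<Rightarrow> 'm TTM \<Rightarrow> 'm TTM" where
  "jacobi_endo A S u \<xi> = (\<lambda>c.
     if c \<in> slit_atlas A \<and> u \<in> cdom c
     then (0, \<chi> i. \<Sum>j\<in>UNIV. jacobi_coeff S c u i j * (fst (\<xi> c) $ j))
     else 0)"

text \<open>\<open>d\<^sub>J F (\<xi>) = (J\<xi>)(F)\<close>.\<close>

definition dJ :: "('m, real^2) chart set \<Rightarrow> ('m TM \<Rightarrow> real) \<Rightarrow> 'm TM \<Rightarrow> 'm TTM \<Rightarrow> real" where
  "dJ A F u \<xi> = vderiv (slit_atlas A) u (Jvec \<xi>) F"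

text \<open>\<open>K\<close> is the flag curvature: \<open>\<Phi> = K (F\<^sup>2 J - F d\<^sub>J F \<otimes> C)\<close>.\<close>

definition flag_curvature ::
  "('m, real^2) chart set \<Rightarrow> ('m TM \<Rightarrow> real) \<Rightarrow> 'm TMfield \<Rightarrow> ('m TM \<Rightarrow> real) \<Rightarrow> bool" where
  "flag_curvature A F S K \<longleftrightarrow>
     smooth_fun (slit_atlas A) K \<and>
     (\<forall>u\<in>slit A. \<forall>\<xi>\<in>tangent_space (slit_atlas A) u.
        jacobi_endo A S u \<xi> =
          (\<lambda>c. K u *\<^sub>R ((F u)\<^sup>2 *\<^sub>R Jvec \<xi> c - (F u * dJ A F u \<xi>) *\<^sub>R Liouville A u c)))"

definition nonflat :: "('m, real^2) chart set \<Rightarrow> ('m TM \<Rightarrow> real) \<Rightarrow> bool" where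
  "nonflat A K \<longleftrightarrow> (\<forall>u\<in>slit A. K u \<noteq> 0)"

definition ricci_scalar :: "('m TM \<Rightarrow> real) \<Rightarrow> ('m TM \<Rightarrow> real) \<Rightarrow> 'm TM \<Rightarrow> real" where
  "ricci_scalar F K u = K u * (F u)\<^sup>2"

section \<open>Projectors, Berwald connection and Berwald frame\<close>

definition hproj :: "('m, real^2) chart set \<Rightarrow> 'm TMfield \<Rightarrow> 'm TMfield \<Rightarrow> 'm TMfield" where
  "hproj A S X = vscale (\<lambda>_. 1/2) (vadd X (fn_endo_vec (slit_atlas A) Jst S X))"

definition vproj :: "('m, real^2) chart set \<Rightarrow> 'm TMfield \<Rightarrow> 'm TMfield \<Rightarrow> 'm TMfield" where
  "vproj A S X = vscale (\<lambda>_. 1/2) (vsub X (fn_endo_vec (slit_atlas A) Jst S X))"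

definition theta :: "('m, real^2) chart set \<Rightarrow> 'm TMfield \<Rightarrow> 'm TMfield \<Rightarrow> 'm TMfield" where
  "theta A S X = hproj A S (fn_vec_endo (slit_atlas A) S (hproj A S) X)"

definition berwald_conn ::
  "('m, real^2) chart set \<Rightarrow> 'm TMfield \<Rightarrow> 'm TMfield \<Rightarrow> 'm TMfield \<Rightarrow> 'm TMfield" where
  "berwald_conn A S X Y =
     (let L = lie (slit_atlas A); h = hproj A S; v = vproj A S; \<theta> = theta A S in
      vadd (vadd (v (L (h X) (v Y))) (h (L (v X) (h Y))))
           (vadd (Jst (L (v X) (\<theta> Y))) (\<theta> (L (h X) (Jst Y)))))"

definition eq_on_slit :: "('m, real^2) chart set \<Rightarrow> 'm TMfield \<Rightarrow> 'm TMfield \<Rightarrow> bool" where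
  "eq_on_slit A X Y \<longleftrightarrow> (\<forall>u\<in>slit A. X u = Y u)"

text \<open>The Landsberg scalar \<open>S(I)\<close> belonging to the main scalar \<open>I\<close>.\<close>

definition landsberg ::
  "('m, real^2) chart set \<Rightarrow> 'm TMfield \<Rightarrow> ('m TM \<Rightarrow> real) \<Rightarrow> 'm TM \<Rightarrow> real" where
  "landsberg A S I u = vderiv (slit_atlas A) u (S u) I"

text \<open>\<open>H\<close> determines the Berwald frame \<open>(H, S, JH, C)\<close>, with main scalar \<open>I\<close>.\<close>

definition berwald_frame_gen ::
  "('m, real^2) chart set \<Rightarrow> ('m TM \<Rightarrow> real) \<Rightarrow> 'm TMfield \<Rightarrow> ('m TM \<Rightarrow> real)
     \<Rightarrow> ('m TM \<Rightarrow> real) \<Rightarrow> 'm TMfield \<Rightarrow> bool" where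
  "berwald_frame_gen A F S K I H \<longleftrightarrow>
     (let L = lie (slit_atlas A); V = Jst H in
      vector_field (slit_atlas A) H \<and>
      smooth_fun (slit_atlas A) I \<and>
      eq_on_slit A (hproj A S H) H \<and>
      eq_on_slit A (L (Liouville A) H) H \<and>
      (\<forall>u\<in>slit A. dJ A F u (H u) = 0) \<and>
      eq_on_slit A (L S H) (vscale (ricci_scalar F K) V) \<and>
      eq_on_slit A (L V S) H \<and>
      eq_on_slit A (L H V) (vadd (vadd S (vscale I H)) (vscale (landsberg A S I) V)))"

definition berwald_frame ::
  "('m, real^2) chart set \<Rightarrow> 'm TMfield \<Rightarrow> 'm TMfield \<Rightarrow> nat \<Rightarrow> 'm TMfield" where
  "berwald_frame A S H b = [H, S, Jst H, Liouville A] ! (b - 1)"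

text \<open>One-forms are fields of linear functionals on the tangent spaces. Smoothness of the
  coframe is a consequence of duality.\<close>

definition one_form :: "('m, real^2) chart set \<Rightarrow> ('m TM \<Rightarrow> 'm TTM \<Rightarrow> real) \<Rightarrow> bool" where
  "one_form A \<alpha> \<longleftrightarrow>
     (\<forall>u\<in>slit A. \<forall>\<xi>\<in>tangent_space (slit_atlas A) u. \<forall>\<zeta>\<in>tangent_space (slit_atlas A) u. \<forall>s t.
        \<alpha> u (\<lambda>c. s *\<^sub>R \<xi> c + t *\<^sub>R \<zeta> c) = s * \<alpha> u \<xi> + t * \<alpha> u \<zeta>)"

definition dual_coframe ::
  "('m, real^2) chart set \<Rightarrow> (nat \<Rightarrow> 'm TMfield) \<Rightarrow> (nat \<Rightarrow> 'm TM \<Rightarrow> 'm TTM \<Rightarrow> real) \<Rightarrow> bool" where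
  "dual_coframe A E \<eta> \<longleftrightarrow>
     (\<forall>a\<in>{1..4}. one_form A (\<eta> a)) \<and>
     (\<forall>a\<in>{1..4}. \<forall>b\<in>{1..4}. \<forall>u\<in>slit A. \<eta> a u (E b u) = (if a = b then 1 else 0))"

text \<open>\<open>\<omega>\<^sup>a\<^sub>b(X) = \<eta>\<^sup>a(D\<^sub>X X\<^sub>b)\<close>.\<close>

definition conn_form ::
  "('m, real^2) chart set \<Rightarrow> 'm TMfield \<Rightarrow> (nat \<Rightarrow> 'm TMfield)
     \<Rightarrow> (nat \<Rightarrow> 'm TM \<Rightarrow> 'm TTM \<Rightarrow> real) \<Rightarrow> nat \<Rightarrow> nat \<Rightarrow> 'm TMfield \<Rightarrow> 'm TM \<Rightarrow> real" where
  "conn_form A S E \<eta> a b X u = \<eta> a u (berwald_conn A S X (E b) u)"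

end

theory Submission
  imports Defs
begin

text \<open>
  In an induced chart \<open>z = (x, y)\<close> write \<open>S = (y, s)\<close> and let \<open>N w = 1/2 D s (0, w)\<close>, so that
  \<open>(w, N w)\<close> is the horizontal lift of \<open>w\<close>. A field \<open>X = (p, q)\<close> then has horizontal part
  \<open>(p, N p)\<close> and vertical part \<open>(0, q - N p)\<close>, and \<open>\<theta> X\<close> is the horizontal lift of \<open>q - N p\<close>.
  Substituting this in the four brackets that define the Berwald connection, the derivatives of \<open>X\<close>
  cancel, and everything reduces to one operator on \<open>\<real>\<^sup>2\<close>-valued functions,
  \<open>\<nabla>\<^sub>X w = D w (X) - (D N (0, w)) p\<close>: the derivative of the horizontal lift of \<open>w\<close> is the
  horizontal lift of \<open>\<nabla>\<^sub>X w\<close>, and the derivative of \<open>(0, w)\<close> is \<open>(0, \<nabla>\<^sub>X w)\<close>. This is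
  \<open>rep_berwald_conn\<close>. It shows that the connection is tensorial in \<open>X\<close> and explains why the two
  diagonal blocks of the connection matrix agree.

  Let \<open>a\<close> be the base component of \<open>H\<close>. The frame consists of the horizontal lifts of \<open>a\<close>
  and \<open>y\<close>, which are \<open>H\<close> and \<open>S\<close>, and of their vertical lifts \<open>V\<close> and \<open>C\<close>. So only
  \<open>\<nabla>\<^sub>X a\<close> and \<open>\<nabla>\<^sub>X y\<close> have to be found. That \<open>S\<close> is the horizontal lift of \<open>y\<close>, i.e. \<open>N y = s\<close>,
  is Euler's identity for \<open>s\<close>; the homogeneity of \<open>s\<close> follows from that of \<open>F\<close> because the
  Euler-Lagrange equations determine the spray (\<open>spray_fibre_dil\<close>). Since \<open>N\<close> is homogeneous of degree 1,
  \<open>\<nabla>\<^sub>X y\<close> is the vertical part of \<open>X\<close> (\<open>nabla_snd\<close>). The four values of \<open>\<nabla> a\<close> along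
  the frame are read off from the brackets \<open>[H, V]\<close>, \<open>[C, H]\<close> and \<open>[S, H]\<close> (\<open>nabla_a\<close>).

  To pass from charts to the manifold, \<open>V\<close> and \<open>C\<close> must be tangent vectors, which is checked on
  the coordinate changes \<open>(x, y) \<mapsto> (\<phi> x, D \<phi> x y)\<close>. The dual coframe then separates the frame, so the
  frame is a basis of each tangent space and the coefficients of \<open>X\<close> are the numbers
  \<open>\<eta>\<^sup>i(X)\<close> (\<open>coframe_expansion\<close>).
\<close>

section \<open>Calculus of smooth maps\<close>

lemma Ck_on_cong:
  assumes "open U" "\<And>x. x \<in> U \<Longrightarrow> f x = g x"
  shows "Ck_on k U f \<longleftrightarrow> Ck_on k U g"
  using assms(2)
proof (induction k arbitrary: f g)
  case 0
  then show ?case by (simp cong: continuous_on_cong)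
next
  case (Suc k)
  have d: "f differentiable (at x) \<longleftrightarrow> g differentiable (at x)" if "x \<in> U" for x
    using that Suc.prems assms(1) unfolding differentiable_def
    by (metis has_derivative_transform_within_open)
  show ?case
  proof (cases "\<forall>x\<in>U. f differentiable (at x)")
    case True
    have "frechet_derivative f (at x) = frechet_derivative g (at x)" if "x \<in> U" for x
      using frechet_derivative_transform_within_open[of f x U g] assms(1) True that Suc.prems by blast
    then have "Ck_on k U (\<lambda>x. frechet_derivative f (at x) w) \<longleftrightarrow>
        Ck_on k U (\<lambda>x. frechet_derivative g (at x) w)" for w
      by (intro Suc.IH) auto
    then show ?thesis using d by simp
  next
    case False
    then show ?thesis using d by auto
  qed
qed

lemma Ck_on_SucD: "Ck_on (Suc k) U f \<Longrightarrow> Ck_on k U f"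
proof (induction k arbitrary: f)
  case 0
  then show ?case
    by (auto intro!: continuous_at_imp_continuous_on differentiable_imp_continuous_within)
qed auto

lemma Ck_on_const: "Ck_on k U (\<lambda>x. c)"
  by (induction k arbitrary: c) auto

lemma Ck_on_add:
  assumes "open U"
  shows "Ck_on k U f \<Longrightarrow> Ck_on k U g \<Longrightarrow> Ck_on k U (\<lambda>x. f x + g x)"
proof (induction k arbitrary: f g)
  case 0
  then show ?case by (simp add: continuous_on_add)
next
  case (Suc k)
  have "frechet_derivative (\<lambda>x. f x + g x) (at x) =
      (\<lambda>w. frechet_derivative f (at x) w + frechet_derivative g (at x) w)" if "x \<in> U" for x
    using Suc.prems that
    by (intro frechet_derivative_at[symmetric] has_derivative_add)
       (auto simp flip: frechet_derivative_works)
  then have "Ck_on k U (\<lambda>x. frechet_derivative (\<lambda>x. f x + g x) (at x) w)" for w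
    using Suc Ck_on_cong[OF assms, of "\<lambda>x. frechet_derivative (\<lambda>x. f x + g x) (at x) w"
      "\<lambda>x. frechet_derivative f (at x) w + frechet_derivative g (at x) w"] by auto
  then show ?case using Suc.prems by auto
qed

lemma Ck_on_bilinear:
  assumes "open U" "bounded_bilinear B"
  shows "Ck_on k U f \<Longrightarrow> Ck_on k U g \<Longrightarrow> Ck_on k U (\<lambda>x. B (f x) (g x))"
proof (induction k arbitrary: f g)
  case 0
  then show ?case using bounded_bilinear.continuous_on[OF assms(2)] by auto
next
  case (Suc k)
  have *: "((\<lambda>x. B (f x) (g x)) has_derivative
      (\<lambda>w. B (f x) (frechet_derivative g (at x) w) + B (frechet_derivative f (at x) w) (g x))) (at x)"
    if "x \<in> U" for x
    using Suc.prems that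
    by (intro bounded_bilinear.FDERIV[OF assms(2)]) (auto simp flip: frechet_derivative_works)
  have "Ck_on k U (\<lambda>x. frechet_derivative (\<lambda>x. B (f x) (g x)) (at x) w)" for w
  proof -
    have "Ck_on k U (\<lambda>x. B (f x) (frechet_derivative g (at x) w)
        + B (frechet_derivative f (at x) w) (g x))"
      using Suc.prems Suc.prems[THEN Ck_on_SucD] by (intro Ck_on_add[OF assms(1)] Suc.IH) auto
    then show ?thesis
      by (rule Ck_on_cong[THEN iffD1, OF assms(1), rotated])
        (rule fun_cong[OF frechet_derivative_at[OF *]])
  qed
  then show ?case using * unfolding Ck_on.simps differentiable_def by blast
qed

lemma Ck_on_linear_comp:
  assumes "open U" "bounded_linear L"
  shows "Ck_on k U f \<Longrightarrow> Ck_on k U (\<lambda>x. L (f x))"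
proof (induction k arbitrary: f)
  case 0
  then show ?case using bounded_linear.continuous_on[OF assms(2)] by auto
next
  case (Suc k)
  have *: "((\<lambda>x. L (f x)) has_derivative (\<lambda>w. L (frechet_derivative f (at x) w))) (at x)"
    if "x \<in> U" for x
    using Suc.prems that
    by (intro bounded_linear.has_derivative[OF assms(2)]) (auto simp flip: frechet_derivative_works)
  have "Ck_on k U (\<lambda>x. frechet_derivative (\<lambda>x. L (f x)) (at x) w)" for w
  proof -
    have "Ck_on k U (\<lambda>x. L (frechet_derivative f (at x) w))"
      using Suc by simp
    then show ?thesis
      by (rule Ck_on_cong[THEN iffD1, OF assms(1), rotated])
        (rule fun_cong[OF frechet_derivative_at[OF *]])
  qed
  then show ?case using * unfolding Ck_on.simps differentiable_def by blast
qed

lemma Ck_on_ident: "Ck_on k U (\<lambda>x. x)"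
  by (cases k) (auto intro: Ck_on_const)

lemma smooth_on_cong:
  "open U \<Longrightarrow> (\<And>x. x \<in> U \<Longrightarrow> f x = g x) \<Longrightarrow> smooth_on U f \<longleftrightarrow> smooth_on U g"
  unfolding smooth_on_def using Ck_on_cong by blast

lemma smooth_on_differentiable: "smooth_on U f \<Longrightarrow> x \<in> U \<Longrightarrow> f differentiable (at x)"
  unfolding smooth_on_def using Ck_on.simps(2) by blast

lemma smooth_on_has_derivative:
  "smooth_on U f \<Longrightarrow> x \<in> U \<Longrightarrow> (f has_derivative frechet_derivative f (at x)) (at x)"
  using smooth_on_differentiable frechet_derivative_works by blast

lemma smooth_on_const: "smooth_on U (\<lambda>x. c)"
  unfolding smooth_on_def by (simp add: Ck_on_const)

lemma smooth_on_add:
  "open U \<Longrightarrow> smooth_on U f \<Longrightarrow> smooth_on U g \<Longrightarrow> smooth_on U (\<lambda>x. f x + g x)"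
  unfolding smooth_on_def by (simp add: Ck_on_add)

lemma smooth_on_sum:
  assumes "open U" "\<And>i. i \<in> I \<Longrightarrow> smooth_on U (f i)"
  shows "smooth_on U (\<lambda>x. \<Sum>i\<in>I. f i x)"
  using assms(2) by (induction I rule: infinite_finite_induct)
    (auto intro: smooth_on_const smooth_on_add[OF assms(1)])

lemma smooth_on_linear_comp:
  "open U \<Longrightarrow> bounded_linear L \<Longrightarrow> smooth_on U f \<Longrightarrow> smooth_on U (\<lambda>x. L (f x))"
  unfolding smooth_on_def by (simp add: Ck_on_linear_comp)

lemma smooth_on_linear: "open U \<Longrightarrow> bounded_linear L \<Longrightarrow> smooth_on U L"
  using Ck_on_linear_comp[of U L _ "\<lambda>x. x"] unfolding smooth_on_def by (simp add: Ck_on_ident)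

lemma smooth_on_scaleR:
  "open U \<Longrightarrow> smooth_on U f \<Longrightarrow> smooth_on U g \<Longrightarrow> smooth_on U (\<lambda>x. f x *\<^sub>R g x)"
  unfolding smooth_on_def by (simp add: Ck_on_bilinear bounded_bilinear_scaleR)

lemma smooth_on_mult:
  fixes f g :: "'a::euclidean_space \<Rightarrow> real"
  shows "open U \<Longrightarrow> smooth_on U f \<Longrightarrow> smooth_on U g \<Longrightarrow> smooth_on U (\<lambda>x. f x * g x)"
  unfolding smooth_on_def by (simp add: Ck_on_bilinear bounded_bilinear_mult)

lemma smooth_on_diff:
  "open U \<Longrightarrow> smooth_on U f \<Longrightarrow> smooth_on U g \<Longrightarrow> smooth_on U (\<lambda>x. f x - g x)"
  using smooth_on_add[of U f "\<lambda>x. - g x"]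
    smooth_on_linear_comp[OF _ bounded_linear_minus[OF bounded_linear_ident], of U g] by simp

lemma smooth_on_fst:
  fixes f :: "'a::euclidean_space \<Rightarrow> 'b::real_normed_vector \<times> 'c::real_normed_vector"
  shows "open U \<Longrightarrow> smooth_on U f \<Longrightarrow> smooth_on U (\<lambda>x. fst (f x))"
  using smooth_on_linear_comp[OF _ bounded_linear_fst] by auto

lemma smooth_on_snd:
  fixes f :: "'a::euclidean_space \<Rightarrow> 'b::real_normed_vector \<times> 'c::real_normed_vector"
  shows "open U \<Longrightarrow> smooth_on U f \<Longrightarrow> smooth_on U (\<lambda>x. snd (f x))"
  using smooth_on_linear_comp[OF _ bounded_linear_snd] by auto

lemma smooth_on_Pair:
  assumes "open U" "smooth_on U f" "smooth_on U g"
  shows "smooth_on U (\<lambda>x. (f x, g x))"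
proof -
  have "bounded_linear (\<lambda>y. (y, 0))" "bounded_linear (\<lambda>y. (0, y))"
    by (intro bounded_linear_Pair bounded_linear_ident bounded_linear_zero)+
  then have "smooth_on U (\<lambda>x. (f x, 0) + (0, g x))"
    using smooth_on_linear_comp[OF assms(1) _ assms(2)] smooth_on_linear_comp[OF assms(1) _ assms(3)]
    by (intro smooth_on_add[OF assms(1)])
  then show ?thesis by simp
qed

lemma linear_eq_sum_Basis:
  fixes L :: "'a::euclidean_space \<Rightarrow> 'b::real_vector"
  assumes "linear L"
  shows "L w = (\<Sum>b\<in>Basis. (w \<bullet> b) *\<^sub>R L b)"
proof -
  have "L w = L (\<Sum>b\<in>Basis. (w \<bullet> b) *\<^sub>R b)" by (simp add: euclidean_representation)
  also have "\<dots> = (\<Sum>b\<in>Basis. (w \<bullet> b) *\<^sub>R L b)"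
    using assms by (simp add: linear_sum linear_cmul)
  finally show ?thesis .
qed

text \<open>Smoothness only gives the directional derivatives along fixed vectors; a variable direction is
  expanded in a basis.\<close>

lemma smooth_on_frechet_derivative:
  assumes "open U" "smooth_on U f" "smooth_on U g"
  shows "smooth_on U (\<lambda>x. frechet_derivative f (at x) (g x))"
proof -
  have "smooth_on U (\<lambda>x. frechet_derivative f (at x) w)" for w
    using assms(2) unfolding smooth_on_def by (metis Ck_on.simps(2))
  then have "smooth_on U (\<lambda>x. \<Sum>b\<in>Basis. (g x \<bullet> b) *\<^sub>R frechet_derivative f (at x) b)"
    by (intro smooth_on_sum smooth_on_scaleR assms
        smooth_on_linear_comp[OF assms(1) bounded_linear_inner_left])
  then show ?thesis
    by (subst smooth_on_cong[OF assms(1)])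
      (auto intro!: linear_eq_sum_Basis linear_frechet_derivative smooth_on_differentiable assms)
qed

lemma frechet_derivative_linear_comp:
  assumes "bounded_linear L" "f differentiable (at x)"
  shows "frechet_derivative (\<lambda>x. L (f x)) (at x) w = L (frechet_derivative f (at x) w)"
  using frechet_derivative_at[OF bounded_linear.has_derivative[OF assms(1)
      frechet_derivative_works[THEN iffD1, OF assms(2)]]] by metis

lemmas frechet_derivative_fst = frechet_derivative_linear_comp[OF bounded_linear_fst]
lemmas frechet_derivative_snd = frechet_derivative_linear_comp[OF bounded_linear_snd]

lemma frechet_derivative_Pair:
  assumes "f differentiable (at x)" "g differentiable (at x)"
  shows "frechet_derivative (\<lambda>x. (f x, g x)) (at x) w =
    (frechet_derivative f (at x) w, frechet_derivative g (at x) w)"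
  using frechet_derivative_at[OF has_derivative_Pair[OF
      assms[THEN frechet_derivative_works[THEN iffD1]]]] by metis

text \<open>Expanding the argument in a basis reduces the Leibniz rule for a field of linear maps to
  that for scalar multiples. No topology on the space of linear maps enters, so the rule applies
  to fields that are only known through their values on fixed vectors.\<close>

lemma has_derivative_linear_field:
  fixes L :: "'e::euclidean_space \<Rightarrow> 'b::euclidean_space \<Rightarrow> 'c::real_normed_vector"
  assumes U: "open U" "z \<in> U" and lin: "\<And>x. x \<in> U \<Longrightarrow> linear (L x)"
    and dL: "\<And>b. (\<lambda>x. L x b) differentiable (at z)"
    and da: "(a has_derivative a') (at z)"
  shows "((\<lambda>x. L x (a x)) has_derivative
    (\<lambda>v. L z (a' v) + frechet_derivative (\<lambda>x. L x (a z)) (at z) v)) (at z)"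
proof -
  let ?d = "\<lambda>b. frechet_derivative (\<lambda>x. L x b) (at z)"
  have d: "((\<lambda>x. L x b) has_derivative ?d b) (at z)" for b
    using dL frechet_derivative_works by blast
  have 1: "((\<lambda>x. \<Sum>b\<in>Basis. (a x \<bullet> b) *\<^sub>R L x b) has_derivative
      (\<lambda>v. \<Sum>b\<in>Basis. (a z \<bullet> b) *\<^sub>R ?d b v + (a' v \<bullet> b) *\<^sub>R L z b)) (at z)"
    by (intro has_derivative_sum has_derivative_scaleR has_derivative_inner_left da d)
  have "((\<lambda>x. \<Sum>b\<in>Basis. (a z \<bullet> b) *\<^sub>R L x b) has_derivative
      (\<lambda>v. \<Sum>b\<in>Basis. (a z \<bullet> b) *\<^sub>R ?d b v)) (at z)"
    by (intro has_derivative_sum has_derivative_scaleR_right d)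
  then have "((\<lambda>x. L x (a z)) has_derivative (\<lambda>v. \<Sum>b\<in>Basis. (a z \<bullet> b) *\<^sub>R ?d b v)) (at z)"
    by (rule has_derivative_transform_within_open[OF _ U]) (rule linear_eq_sum_Basis[OF lin, symmetric])
  then have 2: "?d (a z) = (\<lambda>v. \<Sum>b\<in>Basis. (a z \<bullet> b) *\<^sub>R ?d b v)"
    by (rule frechet_derivative_at[symmetric])
  have 3: "L z (a' v) = (\<Sum>b\<in>Basis. (a' v \<bullet> b) *\<^sub>R L z b)" for v
    using linear_eq_sum_Basis[OF lin[OF U(2)]] .
  have "((\<lambda>x. \<Sum>b\<in>Basis. (a x \<bullet> b) *\<^sub>R L x b) has_derivative
      (\<lambda>v. L z (a' v) + ?d (a z) v)) (at z)"
    using 1 unfolding 2 3 by (simp add: sum.distrib add.commute)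
  then show ?thesis
    by (rule has_derivative_transform_within_open[OF _ U]) (rule linear_eq_sum_Basis[OF lin, symmetric])
qed

section \<open>The Berwald connection in an induced chart\<close>

definition chart_rep :: "('p, 'e) chart \<Rightarrow> ('p, 'e) field \<Rightarrow> 'e \<Rightarrow> 'e" where
  "chart_rep c X = (\<lambda>z. X (cinv c z) c)"

lemma chart_rep_vadd: "chart_rep c (vadd X Y) = (\<lambda>z. chart_rep c X z + chart_rep c Y z)"
  by (simp add: chart_rep_def vadd_def fun_eq_iff)

lemma chart_rep_vsub: "chart_rep c (vsub X Y) = (\<lambda>z. chart_rep c X z - chart_rep c Y z)"
  by (simp add: chart_rep_def vsub_def fun_eq_iff)

lemma chart_rep_Jst: "chart_rep c (Jst X) = (\<lambda>z. (0, fst (chart_rep c X z)))"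
  by (simp add: chart_rep_def Jst_def Jvec_def fun_eq_iff)

locale spray_chart =
  fixes A :: "('m, real^2) chart set" and c :: "'m TMchart" and S :: "'m TMfield"
  assumes chart: "c \<in> slit_atlas A"
    and inj_chart: "inj_on (cmap c) (cdom c)"
    and open_image: "open (cmap c ` cdom c)"
    and smooth_spray: "smooth_on (cmap c ` cdom c) (chart_rep c S)"
    and second_order: "\<And>z. z \<in> cmap c ` cdom c \<Longrightarrow> fst (chart_rep c S z) = snd z"
begin

abbreviation "U \<equiv> cmap c ` cdom c"
abbreviation "rep \<equiv> chart_rep c"
abbreviation "smooth_rep X \<equiv> smooth_on U (rep X)"

text \<open>In coordinates \<open>N z w\<close> is \<open>(- G\<^sup>i\<^sub>j w\<^sup>j)\<^sub>i\<close>, so that \<open>(w, N z w)\<close> is the horizontal lift of \<open>w\<close>.\<close>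

definition N :: "(real^2) \<times> (real^2) \<Rightarrow> real^2 \<Rightarrow> real^2" where
  "N z w = (1/2) *\<^sub>R snd (frechet_derivative (rep S) (at z) (0, w))"

text \<open>The Berwald derivative of the vector \<open>w\<close> along \<open>X\<close>, as a section of the pulled back tangent
  bundle. In coordinates
  \<open>(\<nabla>\<^sub>X w)\<^sup>i = X(w\<^sup>i) + (\<partial>G\<^sup>i\<^sub>j / \<partial>y\<^sup>k) X\<^sup>j w\<^sup>k\<close>, where \<open>X\<^sup>j\<close> are the base components
  of \<open>X\<close>.\<close>

definition nabla ::
  "'m TMfield \<Rightarrow> ((real^2) \<times> (real^2) \<Rightarrow> real^2) \<Rightarrow> (real^2) \<times> (real^2) \<Rightarrow> real^2" where
  "nabla X w z = frechet_derivative w (at z) (rep X z)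
    - frechet_derivative (\<lambda>z'. N z' (fst (rep X z))) (at z) (0, w z)"

lemma cinv_in: "z \<in> U \<Longrightarrow> cinv c z \<in> cdom c"
  unfolding cinv_def by (rule inv_into_into)

lemma cmap_cinv: "z \<in> U \<Longrightarrow> cmap c (cinv c z) = z"
  unfolding cinv_def by (rule f_inv_into_f)

lemma rep_lie:
  "z \<in> U \<Longrightarrow> rep (lie (slit_atlas A) X Y) z =
    frechet_derivative (rep Y) (at z) (rep X z) - frechet_derivative (rep X) (at z) (rep Y z)"
  by (simp add: chart_rep_def lie_def chart cinv_in cmap_cinv)

lemma smooth_rep_vsub: "smooth_rep X \<Longrightarrow> smooth_rep Y \<Longrightarrow> smooth_rep (vsub X Y)"
  by (simp add: chart_rep_vsub smooth_on_diff open_image)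

lemma smooth_rep_Jst: "smooth_rep X \<Longrightarrow> smooth_rep (Jst X)"
  by (simp add: chart_rep_Jst smooth_on_Pair smooth_on_const smooth_on_fst open_image)

lemma smooth_rep_lie:
  assumes "smooth_rep X" "smooth_rep Y"
  shows "smooth_rep (lie (slit_atlas A) X Y)"
  using smooth_on_diff[OF open_image smooth_on_frechet_derivative[OF open_image assms(2,1)]
      smooth_on_frechet_derivative[OF open_image assms]]
  by (rule smooth_on_cong[THEN iffD1, OF open_image, rotated]) (simp add: rep_lie)

lemma linear_N:
  assumes "z \<in> U"
  shows "linear (N z)"
proof -
  have lin: "linear (frechet_derivative (rep S) (at z))"
    by (rule linear_frechet_derivative[OF smooth_on_differentiable[OF smooth_spray assms]])
  show ?thesis
    using linear_add[OF lin, of "(0, _)" "(0, _)"] linear_cmul[OF lin, of _ "(0, _)"]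
    by (intro linearI) (simp_all add: N_def scaleR_add_right)
qed

lemma smooth_N: "smooth_on U w \<Longrightarrow> smooth_on U (\<lambda>z. N z (w z))"
  unfolding N_def
  by (intro smooth_on_scaleR smooth_on_const smooth_on_snd smooth_on_frechet_derivative
      smooth_on_Pair open_image smooth_spray)

lemma frechet_derivative_fst_spray:
  assumes "z \<in> U"
  shows "fst (frechet_derivative (rep S) (at z) v) = snd v"
proof -
  have "((\<lambda>z. fst (rep S z)) has_derivative snd) (at z)"
    by (rule has_derivative_transform_within_open[OF _ open_image assms])
      (auto intro!: derivative_eq_intros simp: second_order)
  moreover have "((\<lambda>z. fst (rep S z)) has_derivative
      (\<lambda>v. fst (frechet_derivative (rep S) (at z) v))) (at z)"
    by (intro has_derivative_fst smooth_on_has_derivative[OF smooth_spray assms])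
  ultimately show ?thesis using has_derivative_unique by metis
qed

lemma frechet_derivative_spray_vertical:
  "z \<in> U \<Longrightarrow> frechet_derivative (rep S) (at z) (0, w) = (w, 2 *\<^sub>R N z w)"
  by (rule prod_eqI) (simp_all add: frechet_derivative_fst_spray N_def)

text \<open>All derivatives of the components of \<open>X\<close> cancel: \<open>[J, S]\<close> is \<open>(p, q) \<mapsto> (p, 2 N p - q)\<close>.\<close>

lemma rep_fn_endo_vec:
  assumes X: "smooth_rep X" and z: "z \<in> U"
  shows "rep (fn_endo_vec (slit_atlas A) Jst S X) z =
    (fst (rep X z), 2 *\<^sub>R N z (fst (rep X z)) - snd (rep X z))"
proof -
  note d = smooth_on_differentiable[OF X z]
  have d': "(\<lambda>z. fst (rep X z)) differentiable (at z)"
    using smooth_on_differentiable[OF smooth_on_fst[OF open_image X] z] .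
  show ?thesis
    by (simp add: fn_endo_vec_def chart_rep_vsub chart_rep_Jst rep_lie[OF z] d d'
        frechet_derivative_Pair frechet_derivative_fst frechet_derivative_fst_spray[OF z]
        frechet_derivative_spray_vertical[OF z])
qed

lemma rep_hproj:
  assumes "smooth_rep X" "z \<in> U"
  shows "rep (hproj A S X) z = (fst (rep X z), N z (fst (rep X z)))"
  using rep_fn_endo_vec[OF assms]
  by (intro prod_eqI) (simp_all add: hproj_def chart_rep_def vscale_def vadd_def algebra_simps
      flip: scaleR_2)

lemma rep_vproj:
  assumes "smooth_rep X" "z \<in> U"
  shows "rep (vproj A S X) z = (0, snd (rep X z) - N z (fst (rep X z)))"
  using rep_fn_endo_vec[OF assms]
  by (intro prod_eqI) (simp_all add: vproj_def chart_rep_def vscale_def vsub_def algebra_simps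
      flip: scaleR_2)

lemma smooth_rep_hproj:
  assumes X: "smooth_rep X"
  shows "smooth_rep (hproj A S X)"
proof -
  have "smooth_on U (\<lambda>z. (fst (rep X z), N z (fst (rep X z))))"
    by (intro smooth_on_Pair smooth_N smooth_on_fst open_image X)
  then show ?thesis
    by (rule smooth_on_cong[THEN iffD1, OF open_image, rotated]) (simp add: rep_hproj X)
qed

lemma smooth_rep_vproj:
  assumes X: "smooth_rep X"
  shows "smooth_rep (vproj A S X)"
proof -
  have "smooth_on U (\<lambda>z. (0, snd (rep X z) - N z (fst (rep X z))))"
    by (intro smooth_on_Pair smooth_N smooth_on_fst smooth_on_snd smooth_on_diff smooth_on_const
        open_image X)
  then show ?thesis
    by (rule smooth_on_cong[THEN iffD1, OF open_image, rotated]) (simp add: rep_vproj X)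
qed

lemma frechet_derivative_cong:
  assumes f: "smooth_on U f" and z: "z \<in> U" and eq: "\<And>z. z \<in> U \<Longrightarrow> f z = g z"
  shows "frechet_derivative f (at z) = frechet_derivative g (at z)"
  using frechet_derivative_transform_within_open[OF smooth_on_differentiable[OF f z] open_image z] eq
  by blast

lemma frechet_derivative_rep_hproj:
  assumes X: "smooth_rep X" and z: "z \<in> U"
  shows "frechet_derivative (rep (hproj A S X)) (at z) v =
    (frechet_derivative (\<lambda>z. fst (rep X z)) (at z) v,
     frechet_derivative (\<lambda>z. N z (fst (rep X z))) (at z) v)"
proof -
  have s: "smooth_on U (\<lambda>z. fst (rep X z))" by (rule smooth_on_fst[OF open_image X])
  show ?thesis
    by (subst frechet_derivative_cong[OF smooth_rep_hproj[OF X] z, OF rep_hproj[OF X]])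
      (auto intro!: frechet_derivative_Pair smooth_on_differentiable[OF _ z] s smooth_N)
qed

text \<open>The base component of \<open>[S, W]\<close> is \<open>D w (S) - w'\<close> for \<open>W = (w, w')\<close>. As \<open>X\<close> and its horizontal
  part have the same base component, the derivatives cancel in \<open>[S, h X] - h [S, X]\<close> and leave the
  vertical component of \<open>X\<close>.\<close>

lemma rep_theta:
  assumes X: "smooth_rep X" and z: "z \<in> U"
  shows "rep (theta A S X) z =
    (snd (rep X z) - N z (fst (rep X z)), N z (snd (rep X z) - N z (fst (rep X z))))"
proof -
  let ?W = "fn_vec_endo (slit_atlas A) S (hproj A S) X"
  note d = smooth_on_differentiable[OF X z]
  have sW: "smooth_rep ?W" unfolding fn_vec_endo_def
    by (intro smooth_rep_vsub smooth_rep_lie smooth_rep_hproj smooth_spray X)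
  have "fst (rep ?W z) = snd (rep X z) - N z (fst (rep X z))"
    by (simp add: fn_vec_endo_def chart_rep_vsub rep_lie[OF z] smooth_rep_lie smooth_spray X
        rep_hproj[OF _ z] frechet_derivative_rep_hproj[OF X z] frechet_derivative_fst_spray[OF z]
        frechet_derivative_fst[OF d])
  then show ?thesis
    unfolding theta_def by (simp add: rep_hproj[OF sW z])
qed

lemma smooth_rep_theta:
  assumes X: "smooth_rep X"
  shows "smooth_rep (theta A S X)"
  unfolding theta_def fn_vec_endo_def
  by (intro smooth_rep_hproj smooth_rep_vsub smooth_rep_lie smooth_spray X)

lemma has_derivative_N:
  assumes w: "smooth_on U w" and z: "z \<in> U"
  shows "((\<lambda>z. N z (w z)) has_derivative (\<lambda>v. N z (frechet_derivative w (at z) v)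
    + frechet_derivative (\<lambda>z'. N z' (w z)) (at z) v)) (at z)"
  by (rule has_derivative_linear_field[OF open_image z linear_N])
    (assumption | rule smooth_on_differentiable[OF smooth_N[OF smooth_on_const] z]
       smooth_on_has_derivative[OF w z])+

lemma frechet_derivative_N:
  assumes "smooth_on U w" "z \<in> U"
  shows "frechet_derivative (\<lambda>z. N z (w z)) (at z) v = N z (frechet_derivative w (at z) v)
    + frechet_derivative (\<lambda>z'. N z' (w z)) (at z) v"
  by (rule fun_cong[OF frechet_derivative_at[OF has_derivative_N[OF assms], symmetric]])

text \<open>The bracket with \<open>v X\<close> and the bracket with \<open>h X\<close> each differentiate the components of \<open>Y\<close> along
  one part of \<open>X\<close>, and the sum is the full derivative along \<open>X\<close>. Projection removes the derivatives
  of \<open>X\<close>, except that differentiating \<open>h X = (p, N p)\<close> leaves the derivative of \<open>N\<close>.\<close>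

lemma rep_berwald_conn:
  assumes X: "smooth_rep X" and Y: "smooth_rep Y" and z: "z \<in> U"
  defines "a \<equiv> \<lambda>z. fst (rep Y z)" and "\<beta> \<equiv> \<lambda>z. snd (rep Y z) - N z (fst (rep Y z))"
  shows "rep (berwald_conn A S X Y) z = (nabla X a z, N z (nabla X a z) + nabla X \<beta> z)"
proof -
  let ?L = "lie (slit_atlas A)" and ?h = "hproj A S" and ?v = "vproj A S" and ?t = "theta A S"
  let ?D = "\<lambda>f. frechet_derivative f (at z)"
  define p where "p = (\<lambda>z. fst (rep X z))"
  define b where "b = (\<lambda>z. snd (rep X z) - N z (p z))"
  have sp: "smooth_on U p" and sa: "smooth_on U a"
    unfolding p_def a_def by (intro smooth_on_fst open_image X Y)+
  have s\<beta>: "smooth_on U \<beta>"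
    unfolding \<beta>_def by (intro smooth_on_diff smooth_N smooth_on_fst smooth_on_snd open_image Y)
  note sm = smooth_rep_hproj smooth_rep_vproj smooth_rep_theta smooth_rep_lie smooth_rep_Jst X Y
  note lin = linear_N[OF z]
  note df = smooth_on_differentiable[OF _ z]
  note cong = frechet_derivative_cong[OF _ z]
  have dhX: "?D (rep (?h X)) v = (?D p v, N z (?D p v) + ?D (\<lambda>z'. N z' (p z)) v)" for v
    using frechet_derivative_rep_hproj[OF X z] frechet_derivative_N[OF sp z] unfolding p_def by simp
  have dhY: "fst (?D (rep (?h Y)) v) = ?D a v" for v
    using frechet_derivative_rep_hproj[OF Y z] unfolding a_def by simp
  have dvY: "?D (rep (?v Y)) v = (0, ?D \<beta> v)" for v
    by (subst cong[OF smooth_rep_vproj[OF Y] rep_vproj[OF Y]])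
      (auto simp: frechet_derivative_Pair df s\<beta> simp flip: \<beta>_def)
  have dJY: "?D (rep (Jst Y)) v = (0, ?D a v)" for v
  proof -
    have "rep (Jst Y) = (\<lambda>z. (0, a z))" by (simp add: chart_rep_Jst a_def)
    then show ?thesis by (simp add: frechet_derivative_Pair df sa)
  qed
  have dvX: "fst (?D (rep (?v X)) v) = 0" for v
  proof -
    have "?D (rep (?v X)) v = (0, ?D b v)"
      by (subst cong[OF smooth_rep_vproj[OF X] rep_vproj[OF X]])
        (auto simp: frechet_derivative_Pair df b_def p_def smooth_on_diff smooth_N smooth_on_fst
          smooth_on_snd open_image X)
    then show ?thesis by simp
  qed
  have dtY: "fst (?D (rep (?t Y)) v) = ?D \<beta> v" for v
    by (subst cong[OF smooth_rep_theta[OF Y] rep_theta[OF Y]])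
      (auto simp: frechet_derivative_Pair df s\<beta> smooth_N simp flip: \<beta>_def)
  have hX: "rep (?h X) z = (p z, N z (p z))" and vX: "rep (?v X) z = (0, b z)"
    and hY: "rep (?h Y) z = (a z, N z (a z))" and vY: "rep (?v Y) z = (0, \<beta> z)"
    and JY: "rep (Jst Y) z = (0, a z)"
    using rep_hproj[OF X z] rep_vproj[OF X z] rep_hproj[OF Y z] rep_vproj[OF Y z]
    by (simp_all add: p_def a_def b_def \<beta>_def chart_rep_Jst)
  have split: "rep X z = (p z, N z (p z)) + (0, b z)"
    by (simp add: b_def p_def)
  have D_split: "?D w (rep X z) = ?D w (p z, N z (p z)) + ?D w (0, b z)" if "smooth_on U w" for w :: "_ \<Rightarrow> real^2"
    unfolding split using linear_add[OF linear_frechet_derivative[OF df[OF that]]] .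
  have 1: "rep (?v (?L (?h X) (?v Y))) z =
      (0, ?D \<beta> (p z, N z (p z)) - ?D (\<lambda>z'. N z' (p z)) (0, \<beta> z))"
    by (simp add: rep_vproj[OF _ z] sm rep_lie[OF z] hX vY dhX dvY linear_neg[OF lin])
  have 2: "rep (?h (?L (?v X) (?h Y))) z = (?D a (0, b z), N z (?D a (0, b z)))"
    by (simp add: rep_hproj[OF _ z] sm rep_lie[OF z] hY vX dhY dvX)
  have 3: "rep (Jst (?L (?v X) (?t Y))) z = (0, ?D \<beta> (0, b z))"
    by (simp add: chart_rep_Jst rep_lie[OF z] vX dtY dvX)
  have 4: "rep (?t (?L (?h X) (Jst Y))) z =
     (?D a (p z, N z (p z)) - ?D (\<lambda>z'. N z' (p z)) (0, a z),
      N z (?D a (p z, N z (p z)) - ?D (\<lambda>z'. N z' (p z)) (0, a z)))"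
    by (simp add: rep_theta[OF _ z] sm rep_lie[OF z] hX JY dhX dJY linear_neg[OF lin])
  have na: "nabla X a z = ?D a (0, b z) + (?D a (p z, N z (p z)) - ?D (\<lambda>z'. N z' (p z)) (0, a z))"
    unfolding nabla_def D_split[OF sa] by (simp add: p_def)
  have nb: "nabla X \<beta> z = ?D \<beta> (0, b z) + ?D \<beta> (p z, N z (p z)) - ?D (\<lambda>z'. N z' (p z)) (0, \<beta> z)"
    unfolding nabla_def D_split[OF s\<beta>] by (simp add: p_def)
  show ?thesis
    unfolding berwald_conn_def Let_def chart_rep_vadd 1 2 3 4 na nb
    by (simp add: linear_add[OF lin] linear_diff[OF lin] algebra_simps)
qed

end

section \<open>Homogeneity of the geodesic spray\<close>

definition fibre_dil :: "real \<Rightarrow> 'a::real_vector \<times> 'b::real_vector \<Rightarrow> 'a \<times> 'b" where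
  "fibre_dil t z = (fst z, t *\<^sub>R snd z)"

lemma bounded_linear_fibre_dil: "bounded_linear (fibre_dil t)" for t :: real
  unfolding fibre_dil_def
  by (intro bounded_linear_Pair bounded_linear_fst
      bounded_linear_compose[OF bounded_linear_scaleR_right bounded_linear_snd])

lemma frechet_derivative_fibre_dil:
  fixes f :: "'a::real_normed_vector \<times> 'b::real_normed_vector \<Rightarrow> 'c::real_normed_vector"
  assumes U: "open U" "z \<in> U" and f: "f differentiable (at z)" "f differentiable (at (fibre_dil t z))"
    and hom: "\<And>z. z \<in> U \<Longrightarrow> f (fibre_dil t z) = k *\<^sub>R f z"
  shows "frechet_derivative f (at (fibre_dil t z)) (fibre_dil t v) = k *\<^sub>R frechet_derivative f (at z) v"
proof -
  have "((\<lambda>z. f (fibre_dil t z)) has_derivative (\<lambda>v. frechet_derivative f (at (fibre_dil t z)) (fibre_dil t v))) (at z)"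
    by (rule has_derivative_compose[OF bounded_linear_imp_has_derivative[OF bounded_linear_fibre_dil]])
      (use f frechet_derivative_works in blast)
  then have 1: "((\<lambda>z. k *\<^sub>R f z) has_derivative (\<lambda>v. frechet_derivative f (at (fibre_dil t z)) (fibre_dil t v))) (at z)"
    by (rule has_derivative_transform_within_open[OF _ U]) (rule hom)
  have 2: "((\<lambda>z. k *\<^sub>R f z) has_derivative (\<lambda>v. k *\<^sub>R frechet_derivative f (at z) v)) (at z)"
    by (rule has_derivative_scaleR_right) (use f frechet_derivative_works in blast)
  show ?thesis by (rule fun_cong[OF has_derivative_unique[OF 1 2]])
qed

lemma euler_homogeneous:
  fixes f :: "'a::real_normed_vector \<times> 'b::real_normed_vector \<Rightarrow> 'c::real_normed_vector"
  assumes f: "f differentiable (at z)" and hom: "\<And>t. t > 0 \<Longrightarrow> f (fibre_dil t z) = t ^ k *\<^sub>R f z"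
  shows "frechet_derivative f (at z) (0, snd z) = real k *\<^sub>R f z"
proof -
  have z: "fibre_dil 1 z = z" by (simp add: fibre_dil_def)
  have "((\<lambda>t. fibre_dil t z) has_derivative (\<lambda>r. (0, r *\<^sub>R snd z))) (at (1::real))"
    unfolding fibre_dil_def by (auto intro!: derivative_eq_intros)
  then have "((\<lambda>t. f (fibre_dil t z)) has_derivative (\<lambda>r. frechet_derivative f (at z) (0, r *\<^sub>R snd z))) (at (1::real))"
    by (rule has_derivative_compose) (use f frechet_derivative_works z in auto)
  then have 1: "((\<lambda>t. t ^ k *\<^sub>R f z) has_derivative
      (\<lambda>r. frechet_derivative f (at z) (0, r *\<^sub>R snd z))) (at (1::real))"
    by (rule has_derivative_transform_within_open[of _ _ _ _ "{0<..}"]) (auto simp: hom)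
  have 2: "((\<lambda>t. t ^ k *\<^sub>R f z) has_derivative (\<lambda>r. (real k * r) *\<^sub>R f z)) (at (1::real))"
    by (auto intro!: derivative_eq_intros)
  show ?thesis using fun_cong[OF has_derivative_unique[OF 1 2], of 1] by simp
qed

text \<open>The chart-level content of a Finsler function and of its geodesic spray.\<close>

locale finsler_chart = spray_chart A c S
  for A :: "('m, real^2) chart set" and c :: "'m TMchart" and S :: "'m TMfield" +
  fixes F :: "'m TM \<Rightarrow> real"
  assumes smooth_sqF: "smooth_on U (sqF F c)"
    and fibre_dil_in: "\<And>z t. z \<in> U \<Longrightarrow> t > 0 \<Longrightarrow> fibre_dil t z \<in> U"
    and sqF_fibre_dil: "\<And>z t. z \<in> U \<Longrightarrow> t > 0 \<Longrightarrow> sqF F c (fibre_dil t z) = t\<^sup>2 * sqF F c z"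
    and metric_rank: "\<And>z. z \<in> U \<Longrightarrow> rank (finsler_metric F c z) = 2"
    and euler_lagrange: "\<And>z j. z \<in> U \<Longrightarrow>
      frechet_derivative (dy j (sqF F c)) (at z) (rep S z) = dx j (sqF F c) z"
begin

lemma smooth_dy: "smooth_on U (dy j (sqF F c))"
  using smooth_on_frechet_derivative[OF open_image smooth_sqF smooth_on_const]
  unfolding dy_def .

lemma metric_nondegenerate:
  assumes z: "z \<in> U" and 0: "\<And>j. frechet_derivative (dy j (sqF F c)) (at z) (0, w) = 0"
  shows "w = 0"
proof -
  let ?g = "finsler_metric F c z"
  have "(transpose ?g *v w) $ j = 0" for j
  proof -
    let ?d = "frechet_derivative (dy j (sqF F c)) (at z)"
    have lin: "linear ?d"
      by (rule linear_frechet_derivative[OF smooth_on_differentiable[OF smooth_dy z]])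
    have "linear (\<lambda>w. ?d (0, w))"
      using linear_add[OF lin, of "(0, _)" "(0, _)"] linear_cmul[OF lin, of _ "(0, _)"]
      by (intro linearI) simp_all
    then have "?d (0, w) = (\<Sum>b\<in>Basis. (w \<bullet> b) *\<^sub>R ?d (0, b))"
      by (rule linear_eq_sum_Basis)
    also have "\<dots> = w $ 1 * ?d (0, axis 1 1) + w $ 2 * ?d (0, axis 2 1)"
      by (simp add: Basis_vec_def UNIV_2 axis_eq_axis inner_axis)
    finally show ?thesis
      using 0[of j] by (simp add: matrix_vector_mult_def transpose_def finsler_metric_def sum_2
        dy_def algebra_simps add_divide_distrib[symmetric])
  qed
  then have "transpose ?g *v w = transpose ?g *v 0"
    by (simp add: vec_eq_iff)
  moreover have "inj ((*v) (transpose ?g))"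
    using metric_rank[OF z] full_rank_injective[of "transpose ?g"] rank_transpose[of ?g] by simp
  ultimately show ?thesis by (metis injD)
qed

text \<open>Both sides of the Euler-Lagrange equations can be pulled back along the dilation. They then say
  that \<open>s(x, t y)\<close> and \<open>t\<^sup>2 s(x, y)\<close> solve the same linear system, whose matrix is twice the metric.\<close>

lemma spray_fibre_dil:
  assumes z: "z \<in> U" and t: "t > 0"
  shows "snd (rep S (fibre_dil t z)) = t\<^sup>2 *\<^sub>R snd (rep S z)"
proof -
  let ?L = "sqF F c" and ?z = "fibre_dil t z" and ?w = "snd (rep S (fibre_dil t z)) - t\<^sup>2 *\<^sub>R snd (rep S z)"
  note dz = fibre_dil_in[OF _ t]
  note dL = smooth_on_differentiable[OF smooth_sqF]
  have D1: "frechet_derivative ?L (at (fibre_dil t z)) (fibre_dil t v) = t\<^sup>2 *\<^sub>R frechet_derivative ?L (at z) v"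
    if "z \<in> U" for z v
    by (rule frechet_derivative_fibre_dil[OF open_image that])
      (use that t in \<open>auto simp: dL dz sqF_fibre_dil\<close>)
  have dy: "dy j ?L (fibre_dil t z) = t *\<^sub>R dy j ?L z" if "z \<in> U" for j z
  proof -
    have "fibre_dil t (0::real^2, axis j 1) = t *\<^sub>R (0, axis j (1::real))" by (simp add: fibre_dil_def)
    then have "t * dy j ?L (fibre_dil t z) = t * (t * dy j ?L z)"
      using D1[OF that, of "(0, axis j 1)"]
        linear_cmul[OF linear_frechet_derivative[OF dL[OF dz[OF that]]], of t "(0, axis j 1)"]
      unfolding dy_def by (auto simp: power2_eq_square)
    then show ?thesis using t by simp
  qed
  have dx: "dx j ?L ?z = t\<^sup>2 * dx j ?L z" for j
    using D1[OF z, of "(axis j 1, 0)"] by (simp add: dx_def fibre_dil_def)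
  have "frechet_derivative (dy j ?L) (at z) (0, ?w) = 0" for j
  proof -
    let ?d = "frechet_derivative (dy j ?L) (at z)"
    have lin: "linear ?d"
      by (rule linear_frechet_derivative[OF smooth_on_differentiable[OF smooth_dy z]])
    have D2: "frechet_derivative (dy j ?L) (at ?z) (fibre_dil t v) = t *\<^sub>R ?d v" for v
      by (rule frechet_derivative_fibre_dil[OF open_image z])
        (use z in \<open>auto simp: smooth_on_differentiable[OF smooth_dy] dz dy\<close>)
    \<comment> \<open>the vector that the dilation carries to the spray at the dilated point\<close>
    define v where "v = (t *\<^sub>R snd z, (1 / t) *\<^sub>R snd (rep S ?z))"
    have "fibre_dil t v = rep S ?z"
      using second_order[OF dz[OF z]] t by (intro prod_eqI) (simp_all add: v_def fibre_dil_def)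
    then have "t\<^sup>2 * dx j ?L z = ?d (t *\<^sub>R v)"
      using D2[of v] euler_lagrange[OF dz[OF z], of j] dx[of j] linear_cmul[OF lin, of t v] by simp
    moreover have "t\<^sup>2 * dx j ?L z = ?d (t\<^sup>2 *\<^sub>R rep S z)"
      using euler_lagrange[OF z, of j] linear_cmul[OF lin, of "t\<^sup>2" "rep S z"] by simp
    moreover have "(0, ?w) = t *\<^sub>R v - t\<^sup>2 *\<^sub>R rep S z"
      using t by (intro prod_eqI) (simp_all add: v_def second_order[OF z] power2_eq_square)
    ultimately show ?thesis using linear_diff[OF lin, of "t *\<^sub>R v" "t\<^sup>2 *\<^sub>R rep S z"] by simp
  qed
  then have "?w = 0" by (rule metric_nondegenerate[OF z])
  then show ?thesis by simp
qed

lemma N_spray: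
  assumes z: "z \<in> U"
  shows "N z (snd z) = snd (rep S z)"
proof -
  have "frechet_derivative (\<lambda>z. snd (rep S z)) (at z) (0, snd z) = real 2 *\<^sub>R snd (rep S z)"
    by (rule euler_homogeneous)
      (auto intro: smooth_on_differentiable[OF smooth_on_snd[OF open_image smooth_spray] z]
        simp: spray_fibre_dil[OF z])
  then show ?thesis
    by (simp add: N_def frechet_derivative_snd[OF smooth_on_differentiable[OF smooth_spray z]])
qed

lemma N_fibre_dil:
  assumes z: "z \<in> U" and t: "t > 0"
  shows "N (fibre_dil t z) w = t *\<^sub>R N z w"
proof -
  let ?s = "\<lambda>z. snd (rep S z)"
  have d: "?s differentiable (at z)" if "z \<in> U" for z
    using smooth_on_differentiable[OF smooth_on_snd[OF open_image smooth_spray] that] .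
  have "frechet_derivative ?s (at (fibre_dil t z)) (fibre_dil t (0, w)) = t\<^sup>2 *\<^sub>R frechet_derivative ?s (at z) (0, w)"
    by (rule frechet_derivative_fibre_dil[OF open_image z])
      (auto simp: d z fibre_dil_in[OF _ t] spray_fibre_dil[OF _ t])
  moreover have "fibre_dil t (0::real^2, w) = t *\<^sub>R (0, w)" by (simp add: fibre_dil_def)
  ultimately have "t *\<^sub>R frechet_derivative ?s (at (fibre_dil t z)) (0, w) =
      t *\<^sub>R (t *\<^sub>R frechet_derivative ?s (at z) (0, w))"
    using linear_cmul[OF linear_frechet_derivative[OF d[OF fibre_dil_in[OF z t]]], of t "(0, w)"]
    by (simp add: power2_eq_square)
  then have "frechet_derivative ?s (at (fibre_dil t z)) (0, w) = t *\<^sub>R frechet_derivative ?s (at z) (0, w)"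
    using t by (metis less_irrefl scaleR_left_imp_eq)
  then show ?thesis
    by (simp add: N_def frechet_derivative_snd smooth_on_differentiable[OF smooth_spray] z fibre_dil_in[OF z t])
qed

lemma frechet_derivative_N_Liouville:
  assumes z: "z \<in> U"
  shows "frechet_derivative (\<lambda>z. N z w) (at z) (0, snd z) = N z w"
  using euler_homogeneous[of "\<lambda>z. N z w" z 1]
    smooth_on_differentiable[OF smooth_N[OF smooth_on_const] z] N_fibre_dil[OF z] by simp

text \<open>Differentiating \<open>N y = s\<close> in the vertical direction \<open>w\<close> gives \<open>(D N (0, w)) y + N w = 2 N w\<close>.\<close>

lemma frechet_derivative_N_spray:
  assumes z: "z \<in> U"
  shows "frechet_derivative (\<lambda>z'. N z' (snd z)) (at z) (0, w) = N z w"
proof -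
  have sm: "smooth_on U snd" by (rule smooth_on_linear[OF open_image bounded_linear_snd])
  have "frechet_derivative (\<lambda>z. N z (snd z)) (at z) (0, w) =
      frechet_derivative (\<lambda>z. snd (rep S z)) (at z) (0, w)"
    by (subst frechet_derivative_cong[OF smooth_N[OF sm] z N_spray]) auto
  moreover have "\<dots> = N z w + N z w"
    by (simp add: frechet_derivative_snd smooth_on_differentiable[OF smooth_spray z]
        frechet_derivative_spray_vertical[OF z] scaleR_2)
  moreover have "frechet_derivative snd (at z) (0, w) = w"
    using frechet_derivative_at[OF bounded_linear_imp_has_derivative[OF bounded_linear_snd]] by (metis snd_conv)
  ultimately show ?thesis
    using frechet_derivative_N[OF sm z, of "(0, w)"] by simp
qed

lemma linear_frechet_derivative_N:
  assumes z: "z \<in> U"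
  shows "linear (\<lambda>w. frechet_derivative (\<lambda>z'. N z' w) (at z) v)"
proof (rule linearI)
  have d: "((\<lambda>z'. N z' w) has_derivative frechet_derivative (\<lambda>z'. N z' w) (at z)) (at z)" for w
    by (rule smooth_on_has_derivative[OF smooth_N[OF smooth_on_const] z])
  show "frechet_derivative (\<lambda>z'. N z' (w + w')) (at z) v =
    frechet_derivative (\<lambda>z'. N z' w) (at z) v + frechet_derivative (\<lambda>z'. N z' w') (at z) v" for w w'
  proof -
    have "((\<lambda>z'. N z' (w + w')) has_derivative (\<lambda>v. frechet_derivative (\<lambda>z'. N z' w) (at z) v
        + frechet_derivative (\<lambda>z'. N z' w') (at z) v)) (at z)"
      by (rule has_derivative_transform_within_open[OF has_derivative_add[OF d d] open_image z])
        (simp add: linear_add[OF linear_N])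
    then show ?thesis by (rule fun_cong[OF frechet_derivative_at[symmetric]])
  qed
  show "frechet_derivative (\<lambda>z'. N z' (r *\<^sub>R w)) (at z) v =
    r *\<^sub>R frechet_derivative (\<lambda>z'. N z' w) (at z) v" for r w
  proof -
    have "((\<lambda>z'. N z' (r *\<^sub>R w)) has_derivative
        (\<lambda>v. r *\<^sub>R frechet_derivative (\<lambda>z'. N z' w) (at z) v)) (at z)"
      by (rule has_derivative_transform_within_open[OF has_derivative_scaleR_right[OF d] open_image z])
        (simp add: linear_cmul[OF linear_N])
    then show ?thesis by (rule fun_cong[OF frechet_derivative_at[symmetric]])
  qed
qed

lemma nabla_cong:
  assumes "smooth_on U w" "z \<in> U" "\<And>z. z \<in> U \<Longrightarrow> w z = w' z"
  shows "nabla X w z = nabla X w' z"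
  unfolding nabla_def using frechet_derivative_cong[OF assms] assms(2,3) by simp

lemma nabla_zero:
  assumes z: "z \<in> U"
  shows "nabla X (\<lambda>_. 0) z = 0"
proof -
  have "linear (frechet_derivative (\<lambda>z'. N z' (fst (rep X z))) (at z))"
    by (rule linear_frechet_derivative[OF smooth_on_differentiable[OF smooth_N[OF smooth_on_const] z]])
  then show ?thesis by (simp add: nabla_def linear_0 flip: zero_prod_def)
qed

end

section \<open>Covariant derivatives of the Berwald frame\<close>

text \<open>The chart-level content of the Berwald frame. Here \<open>I\<close> and \<open>J\<close> are the main scalar and the
  Landsberg scalar in coordinates; \<open>[S, H] = \<rho> V\<close> enters as the vanishing of its base component.\<close>

locale berwald_chart = finsler_chart A c S F
  for A :: "('m, real^2) chart set" and c :: "'m TMchart" and S :: "'m TMfield"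
    and F :: "'m TM \<Rightarrow> real" +
  fixes H :: "'m TMfield" and I J :: "(real^2) \<times> (real^2) \<Rightarrow> real"
  assumes smooth_H: "smooth_rep H"
    and horizontal_H: "\<And>z. z \<in> U \<Longrightarrow> rep (hproj A S H) z = rep H z"
    and lie_C_H: "\<And>z. z \<in> U \<Longrightarrow> rep (lie (slit_atlas A) (Liouville A) H) z = rep H z"
    and lie_S_H: "\<And>z. z \<in> U \<Longrightarrow> fst (rep (lie (slit_atlas A) S H) z) = 0"
    and lie_H_V: "\<And>z. z \<in> U \<Longrightarrow> rep (lie (slit_atlas A) H (Jst H)) z =
      rep S z + I z *\<^sub>R rep H z + J z *\<^sub>R rep (Jst H) z"
begin

abbreviation "a \<equiv> \<lambda>z. fst (rep H z)"

lemma smooth_a: "smooth_on U a"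
  by (rule smooth_on_fst[OF open_image smooth_H])

lemma smooth_snd: "smooth_on U snd"
  by (rule smooth_on_linear[OF open_image bounded_linear_snd])

lemma rep_H: "z \<in> U \<Longrightarrow> rep H z = (a z, N z (a z))"
  using horizontal_H rep_hproj[OF smooth_H] by simp

lemma snd_H: "z \<in> U \<Longrightarrow> snd (rep H z) = N z (a z)"
  using rep_H by (metis snd_conv)

lemma rep_S: "z \<in> U \<Longrightarrow> rep S z = (snd z, N z (snd z))"
  by (rule prod_eqI) (simp_all add: second_order N_spray)

lemma rep_V: "rep (Jst H) z = (0, a z)"
  by (simp add: chart_rep_Jst)

lemma rep_C: "z \<in> U \<Longrightarrow> rep (Liouville A) z = (0, snd z)"
  by (simp add: chart_rep_def Liouville_def chart cinv_in cmap_cinv)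

lemma smooth_C: "smooth_rep (Liouville A)"
proof -
  have "smooth_on U (\<lambda>z. (0, snd z))"
    by (intro smooth_on_Pair smooth_on_const smooth_snd open_image)
  then show ?thesis
    by (rule smooth_on_cong[THEN iffD1, OF open_image, rotated]) (simp add: rep_C)
qed

text \<open>Along \<open>V\<close> and \<open>C\<close> the values \<open>- y - I a\<close> and \<open>a\<close> are the base components of \<open>[V, H]\<close> and
  \<open>[C, H]\<close>. Along \<open>H\<close> the value \<open>J a\<close> is the vertical part of \<open>[H, V]\<close>. Along \<open>S\<close> the
  value is \<open>0\<close>, because \<open>[S, H]\<close> has no base component.\<close>

lemma nabla_a:
  assumes z: "z \<in> U"
    and X: "rep X z = e1 *\<^sub>R rep H z + e2 *\<^sub>R rep S z + e3 *\<^sub>R rep (Jst H) z + e4 *\<^sub>R rep (Liouville A) z"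
  shows "nabla X a z = (J z * e1 - I z * e3 + e4) *\<^sub>R a z - e3 *\<^sub>R snd z"
proof -
  let ?D = "\<lambda>f. frechet_derivative f (at z)" and ?N = "N z" and ?y = "snd z"
  let ?Da = "?D a" and ?DN = "\<lambda>w. ?D (\<lambda>z'. N z' w) (0, a z)"
  have lin: "linear ?Da"
    by (rule linear_frechet_derivative[OF smooth_on_differentiable[OF smooth_a z]])
  note linN = linear_N[OF z]
  have DH: "?D (rep H) v = (?Da v, ?N (?Da v) + ?D (\<lambda>z'. N z' (a z)) v)" for v
    by (subst frechet_derivative_cong[OF smooth_H z rep_H])
      (auto simp: frechet_derivative_Pair smooth_on_differentiable[OF _ z] smooth_a smooth_N
        frechet_derivative_N[OF smooth_a z])
  have DV: "?D (rep (Jst H)) v = (0, ?Da v)" for v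
    using rep_V frechet_derivative_Pair[of "\<lambda>_. 0" z a]
      smooth_on_differentiable[OF smooth_a z] by (simp add: chart_rep_Jst)
  have DC: "fst (?D (rep (Liouville A)) v) = 0" for v
    by (subst frechet_derivative_cong[OF smooth_C z rep_C])
      (auto simp: frechet_derivative_Pair smooth_on_differentiable[OF smooth_snd z])
  have HV: "?D (rep (Jst H)) (rep H z) - ?D (rep H) (rep (Jst H) z) =
      rep S z + I z *\<^sub>R rep H z + J z *\<^sub>R rep (Jst H) z"
    using lie_H_V[OF z] rep_lie[OF z, of H "Jst H"] by simp
  have V: "?Da (0, a z) = - (?y + I z *\<^sub>R a z)"
  proof -
    have "- ?Da (0, a z) = ?y + I z *\<^sub>R a z"
      using arg_cong[OF HV, of fst] by (simp add: DH DV rep_S[OF z] rep_V)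
    from arg_cong[OF this, of uminus] show ?thesis by simp
  qed
  have HH: "?Da (rep H z) = ?DN (a z) + J z *\<^sub>R a z"
  proof -
    have "?Da (rep H z) - (?N (?Da (0, a z)) + ?DN (a z)) =
        ?N ?y + I z *\<^sub>R ?N (a z) + J z *\<^sub>R a z"
      using arg_cong[OF HV, of snd] by (simp add: DH DV rep_S[OF z] snd_H[OF z] rep_V)
    then show ?thesis
      by (simp add: V linear_neg[OF linN] linear_add[OF linN] linear_diff[OF linN]
          linear_cmul[OF linN] algebra_simps)
  qed
  have C: "?Da (0, ?y) = a z"
    using arg_cong[OF rep_lie[OF z, of "Liouville A" H], of fst] lie_C_H[OF z]
    by (simp add: DH DC rep_C[OF z])
  have SS: "?Da (rep S z) = ?N (a z)"
    using arg_cong[OF rep_lie[OF z, of S H], of fst] lie_S_H[OF z]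
    by (simp add: DH frechet_derivative_fst_spray[OF z] snd_H[OF z])
  have "?Da (rep X z) = e1 *\<^sub>R ?Da (rep H z) + e2 *\<^sub>R ?Da (rep S z)
      + e3 *\<^sub>R ?Da (0, a z) + e4 *\<^sub>R ?Da (0, ?y)"
    unfolding X rep_V rep_C[OF z]
    by (simp only: linear_add[OF lin] linear_cmul[OF lin])
  moreover have "?DN (fst (rep X z)) = e1 *\<^sub>R ?DN (a z) + e2 *\<^sub>R ?N (a z)"
  proof -
    have "fst (rep X z) = e1 *\<^sub>R a z + e2 *\<^sub>R ?y"
      unfolding X rep_S[OF z] rep_V rep_C[OF z] by simp
    then show ?thesis
      using linear_add[OF linear_frechet_derivative_N[OF z]]
        linear_cmul[OF linear_frechet_derivative_N[OF z]] frechet_derivative_N_spray[OF z]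
      by simp
  qed
  ultimately show ?thesis
    unfolding nabla_def HH SS V C by (simp add: algebra_simps)
qed

text \<open>By homogeneity of \<open>N\<close> the correction term is \<open>N\<close> of the base component of \<open>X\<close>; what remains
  is the vertical part of \<open>X\<close>.\<close>

lemma nabla_snd:
  assumes z: "z \<in> U"
    and X: "rep X z = e1 *\<^sub>R rep H z + e2 *\<^sub>R rep S z + e3 *\<^sub>R rep (Jst H) z + e4 *\<^sub>R rep (Liouville A) z"
  shows "nabla X snd z = e3 *\<^sub>R a z + e4 *\<^sub>R snd z"
proof -
  have "frechet_derivative snd (at z) v = snd v" for v
    by (rule fun_cong[OF frechet_derivative_at[OF
        bounded_linear_imp_has_derivative[OF bounded_linear_snd], symmetric]])
  then have "nabla X snd z = snd (rep X z) - N z (fst (rep X z))"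
    by (simp add: nabla_def frechet_derivative_N_Liouville[OF z])
  then show ?thesis
    unfolding X rep_S[OF z] rep_V rep_C[OF z]
    by (simp add: snd_H[OF z] linear_add[OF linear_N[OF z]] linear_cmul[OF linear_N[OF z]])
qed

lemma berwald_conn_horizontal:
  assumes z: "z \<in> U" and X: "smooth_rep X" and Y: "smooth_rep Y"
    and Yw: "\<And>z. z \<in> U \<Longrightarrow> rep Y z = (w z, N z (w z))"
  shows "rep (berwald_conn A S X Y) z = (nabla X w z, N z (nabla X w z))"
proof -
  have "nabla X (\<lambda>z. fst (rep Y z)) z = nabla X w z"
    by (rule nabla_cong[OF smooth_on_fst[OF open_image Y] z]) (simp add: Yw)
  moreover have "nabla X (\<lambda>z. snd (rep Y z) - N z (fst (rep Y z))) z = nabla X (\<lambda>_. 0) z"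
    by (rule nabla_cong[OF _ z])
      (auto intro!: smooth_on_diff smooth_N smooth_on_fst smooth_on_snd open_image Y simp: Yw)
  ultimately show ?thesis
    using rep_berwald_conn[OF X Y z] nabla_zero[OF z] by simp
qed

lemma berwald_conn_vertical:
  assumes z: "z \<in> U" and X: "smooth_rep X" and Y: "smooth_rep Y"
    and Yw: "\<And>z. z \<in> U \<Longrightarrow> rep Y z = (0, w z)"
  shows "rep (berwald_conn A S X Y) z = (0, nabla X w z)"
proof -
  have "nabla X (\<lambda>z. fst (rep Y z)) z = nabla X (\<lambda>_. 0) z"
    by (rule nabla_cong[OF smooth_on_fst[OF open_image Y] z]) (simp add: Yw)
  moreover have "nabla X (\<lambda>z. snd (rep Y z) - N z (fst (rep Y z))) z = nabla X w z"
    by (rule nabla_cong[OF _ z])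
      (auto intro!: smooth_on_diff smooth_N smooth_on_fst smooth_on_snd open_image Y
        simp: Yw linear_0[OF linear_N])
  ultimately show ?thesis
    using rep_berwald_conn[OF X Y z] nabla_zero[OF z] linear_0[OF linear_N[OF z]] by simp
qed

lemma rep_berwald_conn_frame:
  assumes z: "z \<in> U" and sX: "smooth_rep X"
    and X: "rep X z = e1 *\<^sub>R rep H z + e2 *\<^sub>R rep S z + e3 *\<^sub>R rep (Jst H) z + e4 *\<^sub>R rep (Liouville A) z"
  defines "k \<equiv> J z * e1 - I z * e3 + e4"
  shows "rep (berwald_conn A S X H) z = k *\<^sub>R rep H z + (- e3) *\<^sub>R rep S z"
    and "rep (berwald_conn A S X S) z = e3 *\<^sub>R rep H z + e4 *\<^sub>R rep S z"
    and "rep (berwald_conn A S X (Jst H)) z = k *\<^sub>R rep (Jst H) z + (- e3) *\<^sub>R rep (Liouville A) z"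
    and "rep (berwald_conn A S X (Liouville A)) z =
      e3 *\<^sub>R rep (Jst H) z + e4 *\<^sub>R rep (Liouville A) z"
proof -
  note na = nabla_a[OF z X, folded k_def] and ns = nabla_snd[OF z X]
  note lin = linear_diff[OF linear_N[OF z]] linear_add[OF linear_N[OF z]] linear_cmul[OF linear_N[OF z]]
  show "rep (berwald_conn A S X H) z = k *\<^sub>R rep H z + (- e3) *\<^sub>R rep S z"
    using berwald_conn_horizontal[OF z sX smooth_H, of a, OF rep_H]
    unfolding na by (intro prod_eqI) (simp_all add: rep_S[OF z] snd_H[OF z] lin)
  show "rep (berwald_conn A S X S) z = e3 *\<^sub>R rep H z + e4 *\<^sub>R rep S z"
    using berwald_conn_horizontal[OF z sX smooth_spray, of snd, OF rep_S]
    unfolding ns by (intro prod_eqI) (simp_all add: rep_S[OF z] snd_H[OF z] lin)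
  show "rep (berwald_conn A S X (Jst H)) z = k *\<^sub>R rep (Jst H) z + (- e3) *\<^sub>R rep (Liouville A) z"
    using berwald_conn_vertical[OF z sX smooth_rep_Jst[OF smooth_H], of a, OF rep_V]
    unfolding na rep_V rep_C[OF z] by simp
  show "rep (berwald_conn A S X (Liouville A)) z =
      e3 *\<^sub>R rep (Jst H) z + e4 *\<^sub>R rep (Liouville A) z"
    using berwald_conn_vertical[OF z sX smooth_C, of snd, OF rep_C]
    unfolding ns rep_V rep_C[OF z] by simp
qed

end

section \<open>Coordinate changes on the slit tangent bundle\<close>

lemma tangent_spaceI:
  assumes "\<And>c c'. c \<in> B \<Longrightarrow> c' \<in> B \<Longrightarrow> p \<in> cdom c \<Longrightarrow> p \<in> cdom c' \<Longrightarrow>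
      \<xi> c' = frechet_derivative (cmap c' \<circ> cinv c) (at (cmap c p)) (\<xi> c)"
    and "\<And>c. c \<notin> B \<or> p \<notin> cdom c \<Longrightarrow> \<xi> c = 0"
  shows "\<xi> \<in> tangent_space B p"
  unfolding tangent_space_def mem_Collect_eq using assms by (intro conjI ballI allI impI) blast+

lemma tangent_spaceD:
  assumes "\<xi> \<in> tangent_space B p" "c \<in> B" "p \<in> cdom c" "c' \<in> B" "p \<in> cdom c'"
  shows "\<xi> c' = frechet_derivative (cmap c' \<circ> cinv c) (at (cmap c p)) (\<xi> c)"
  using assms unfolding tangent_space_def by blast

lemma tangent_space_outside:
  "\<xi> \<in> tangent_space B p \<Longrightarrow> c \<notin> B \<or> p \<notin> cdom c \<Longrightarrow> \<xi> c = 0"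
  unfolding tangent_space_def by blast

lemma tangent_space_eqI:
  assumes "\<xi> \<in> tangent_space B p" "\<zeta> \<in> tangent_space B p" "c \<in> B" "p \<in> cdom c" "\<xi> c = \<zeta> c"
  shows "\<xi> = \<zeta>"
proof
  fix c'
  show "\<xi> c' = \<zeta> c'"
  proof (cases "c' \<in> B \<and> p \<in> cdom c'")
    case True
    then show ?thesis
      using tangent_spaceD[OF assms(1,3,4)] tangent_spaceD[OF assms(2,3,4)] assms(5) by simp
  next
    case False
    then show ?thesis
      using tangent_space_outside[OF assms(1)] tangent_space_outside[OF assms(2)] by simp
  qed
qed

lemma tangent_space_linear_comb:
  assumes "\<xi> \<in> tangent_space B p" "\<zeta> \<in> tangent_space B p"
    and "\<And>c c'. c \<in> B \<Longrightarrow> c' \<in> B \<Longrightarrow> p \<in> cdom c \<inter> cdom c' \<Longrightarrow>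
      linear (frechet_derivative (cmap c' \<circ> cinv c) (at (cmap c p)))"
  shows "(\<lambda>c. s *\<^sub>R \<xi> c + t *\<^sub>R \<zeta> c) \<in> tangent_space B p"
proof (rule tangent_spaceI)
  fix c c'
  assume c: "c \<in> B" "c' \<in> B" "p \<in> cdom c" "p \<in> cdom c'"
  then have lin: "linear (frechet_derivative (cmap c' \<circ> cinv c) (at (cmap c p)))"
    using assms(3) by blast
  show "s *\<^sub>R \<xi> c' + t *\<^sub>R \<zeta> c' =
      frechet_derivative (cmap c' \<circ> cinv c) (at (cmap c p)) (s *\<^sub>R \<xi> c + t *\<^sub>R \<zeta> c)"
    unfolding linear_add[OF lin] linear_cmul[OF lin]
      tangent_spaceD[OF assms(1) c(1,3,2,4)] tangent_spaceD[OF assms(2) c(1,3,2,4)] ..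
qed (simp add: tangent_space_outside[OF assms(1)] tangent_space_outside[OF assms(2)])

locale smooth_surface =
  fixes A :: "('m::{t2_space,second_countable_topology}, real^2) chart set"
  assumes manifold: "smooth_manifold A"
begin

abbreviation "transition c c' \<equiv> cmap c' \<circ> cinv c"
abbreviation "overlap c c' \<equiv> cmap c ` (cdom c \<inter> cdom c')"
abbreviation "trD c c' x \<equiv> frechet_derivative (transition c c') (at x)"

lemma exists_chart: "\<exists>c\<in>A. p \<in> cdom c"
  using manifold unfolding smooth_manifold_def by blast

lemma cinv_cmap: "c \<in> A \<Longrightarrow> p \<in> cdom c \<Longrightarrow> cinv c (cmap c p) = p"
  using manifold unfolding smooth_manifold_def homeomorphism_def by blast

lemma open_chart_image: "c \<in> A \<Longrightarrow> open (cmap c ` cdom c)"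
  using manifold unfolding smooth_manifold_def by blast

lemma smooth_transition: "c \<in> A \<Longrightarrow> c' \<in> A \<Longrightarrow> smooth_on (overlap c c') (transition c c')"
  using manifold unfolding smooth_manifold_def by blast

lemma open_overlap:
  assumes "c \<in> A" "c' \<in> A"
  shows "open (overlap c c')"
proof -
  have "continuous_on (cmap c ` cdom c) (cinv c)" "open (cdom c')"
    using manifold assms unfolding smooth_manifold_def homeomorphism_def by blast+
  then have "open (cmap c ` cdom c \<inter> cinv c -` cdom c')"
    using continuous_open_preimage open_chart_image[OF assms(1)] by blast
  also have "cmap c ` cdom c \<inter> cinv c -` cdom c' = overlap c c'"
    using cinv_cmap[OF assms(1)] by fastforce
  finally show ?thesis .
qed

lemma transition_has_derivative:
  "c \<in> A \<Longrightarrow> c' \<in> A \<Longrightarrow> x \<in> overlap c c' \<Longrightarrow> (transition c c' has_derivative trD c c' x) (at x)"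
  by (rule smooth_on_has_derivative[OF smooth_transition])

lemma trD_self:
  assumes c: "c \<in> A" and p: "p \<in> cdom c"
  shows "trD c c (cmap c p) w = w"
proof -
  have "((\<lambda>x. x) has_derivative (\<lambda>w. w)) (at (cmap c p))" by simp
  then have "(transition c c has_derivative (\<lambda>w. w)) (at (cmap c p))"
    by (rule has_derivative_transform_within_open[OF _ open_overlap[OF c c]])
      (use p cinv_cmap[OF c] in auto)
  then show ?thesis by (rule fun_cong[OF frechet_derivative_at[symmetric]])
qed

lemma trD_cocycle:
  assumes c: "c \<in> A" "c1 \<in> A" "c2 \<in> A" and p: "p \<in> cdom c" "p \<in> cdom c1" "p \<in> cdom c2"
  shows "trD c c2 (cmap c p) w = trD c1 c2 (cmap c1 p) (trD c c1 (cmap c p) w)"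
proof -
  let ?x = "cmap c p"
  have x: "transition c c1 ?x = cmap c1 p" using cinv_cmap c p by simp
  have d: "(transition c1 c2 has_derivative trD c1 c2 (cmap c1 p)) (at (transition c c1 ?x))"
    unfolding x using c p by (intro transition_has_derivative) auto
  have "((\<lambda>y. transition c1 c2 (transition c c1 y)) has_derivative
      (\<lambda>w. trD c1 c2 (cmap c1 p) (trD c c1 ?x w))) (at ?x)"
    by (rule has_derivative_compose[OF transition_has_derivative[OF c(1,2)] d]) (use p in auto)
  then have "(transition c c2 has_derivative (\<lambda>w. trD c1 c2 (cmap c1 p) (trD c c1 ?x w))) (at ?x)"
    by (rule has_derivative_transform_within_open[OF _ open_overlap[OF c(1,2)]])
      (use p in \<open>auto simp: cinv_cmap[OF c(1)] cinv_cmap[OF c(2)]\<close>)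
  then show ?thesis by (rule fun_cong[OF frechet_derivative_at[symmetric]])
qed

lemma linear_trD: "c \<in> A \<Longrightarrow> c' \<in> A \<Longrightarrow> x \<in> overlap c c' \<Longrightarrow> linear (trD c c' x)"
  by (rule has_derivative_linear[OF transition_has_derivative])

text \<open>The tangent vector at \<open>p\<close> with components \<open>w\<close> in the chart \<open>c\<close>.\<close>

definition tangent_of :: "('m, real^2) chart \<Rightarrow> 'm \<Rightarrow> real^2 \<Rightarrow> ('m, real^2) chart \<Rightarrow> real^2" where
  "tangent_of c p w = (\<lambda>c'. if c' \<in> A \<and> p \<in> cdom c' then trD c c' (cmap c p) w else 0)"

lemma tangent_of_in:
  assumes "c \<in> A" "p \<in> cdom c"
  shows "tangent_of c p w \<in> tangent_space A p"
proof (rule tangent_spaceI)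
  fix c1 c2
  assume "c1 \<in> A" "c2 \<in> A" "p \<in> cdom c1" "p \<in> cdom c2"
  then show "tangent_of c p w c2 = trD c1 c2 (cmap c1 p) (tangent_of c p w c1)"
    using trD_cocycle[of c c1 c2 p w] assms by (simp add: tangent_of_def)
qed (auto simp: tangent_of_def)

lemma tangent_of_self: "c \<in> A \<Longrightarrow> p \<in> cdom c \<Longrightarrow> tangent_of c p w c = w"
  by (simp add: tangent_of_def trD_self)

lemma tangent_dilation:
  assumes "\<xi> \<in> tangent_space A p"
  shows "(\<lambda>c. t *\<^sub>R \<xi> c) \<in> tangent_space A p"
proof -
  have "(\<lambda>c. t *\<^sub>R \<xi> c + 0 *\<^sub>R \<xi> c) \<in> tangent_space A p"
    by (rule tangent_space_linear_comb[OF assms assms linear_trD]) auto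
  then show ?thesis by simp
qed

lemma slit_iff: "u \<in> slit A \<longleftrightarrow> snd u \<in> tangent_space A (fst u) \<and> snd u \<noteq> (\<lambda>_. 0)"
proof -
  have "fst u \<in> (\<Union>c\<in>A. cdom c)" using exists_chart by blast
  then show ?thesis by (simp add: slit_def tangent_bundle_def split_beta)
qed

lemma cdom_induced: "cdom (induced_chart A c) = {u \<in> slit A. fst u \<in> cdom c}"
  by (simp add: induced_chart_def)

lemma cmap_induced: "cmap (induced_chart A c) u = (cmap c (fst u), snd u c)"
  by (simp add: induced_chart_def)

lemma inj_induced:
  assumes c: "c \<in> A"
  shows "inj_on (cmap (induced_chart A c)) (cdom (induced_chart A c))"
proof (rule inj_onI)
  fix u v
  assume u: "u \<in> cdom (induced_chart A c)" and v: "v \<in> cdom (induced_chart A c)"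
    and eq: "cmap (induced_chart A c) u = cmap (induced_chart A c) v"
  from u v have uv: "fst u \<in> cdom c" "fst v \<in> cdom c" "snd u \<in> tangent_space A (fst u)"
    "snd v \<in> tangent_space A (fst v)" by (simp_all add: cdom_induced slit_iff)
  from eq have eq': "cmap c (fst u) = cmap c (fst v)" "snd u c = snd v c"
    by (simp_all add: cmap_induced)
  have p: "fst u = fst v"
    using arg_cong[OF eq'(1), of "cinv c"] unfolding cinv_cmap[OF c uv(1)] cinv_cmap[OF c uv(2)] .
  moreover have "snd u = snd v"
    by (rule tangent_space_eqI[OF uv(3) uv(4)[folded p] c uv(1) eq'(2)])
  ultimately show "u = v" by (rule prod_eqI)
qed

lemma cinv_induced_cmap:
  "c \<in> A \<Longrightarrow> u \<in> cdom (induced_chart A c) \<Longrightarrow> cinv (induced_chart A c) (cmap (induced_chart A c) u) = u"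
  unfolding cinv_def by (rule inv_into_f_f[OF inj_induced])

lemma tangent_of_induced:
  assumes c: "c \<in> A" and p: "p \<in> cdom c" and w: "w \<noteq> 0"
  shows "(p, tangent_of c p w) \<in> cdom (induced_chart A c)"
    and "cmap (induced_chart A c) (p, tangent_of c p w) = (cmap c p, w)"
proof -
  note self = tangent_of_self[OF c p, of w]
  then have "tangent_of c p w \<noteq> (\<lambda>_. 0)" using w by metis
  then show "(p, tangent_of c p w) \<in> cdom (induced_chart A c)"
    using tangent_of_in[OF c p, of w] p by (simp add: cdom_induced slit_iff)
  show "cmap (induced_chart A c) (p, tangent_of c p w) = (cmap c p, w)"
    by (simp add: cmap_induced self)
qed

lemma nonzero_component:
  assumes c: "c \<in> A" and u: "u \<in> cdom (induced_chart A c)"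
  shows "snd u c \<noteq> 0"
proof
  assume 0: "snd u c = 0"
  have u': "snd u \<in> tangent_space A (fst u)" "snd u \<noteq> (\<lambda>_. 0)" "fst u \<in> cdom c"
    using u by (auto simp: cdom_induced slit_iff)
  have "snd u = (\<lambda>c. 0 *\<^sub>R snd u c)"
    by (rule tangent_space_eqI[OF u'(1) tangent_dilation[OF u'(1)] c u'(3)]) (simp add: 0)
  with u'(2) show False by simp
qed

lemma overlapE:
  assumes "z \<in> overlap c c' \<times> (- {0})"
  obtains p where "p \<in> cdom c" "p \<in> cdom c'" "fst z = cmap c p" "snd z \<noteq> 0"
proof -
  have "fst z \<in> overlap c c'" "snd z \<noteq> 0" using assms by (simp_all add: mem_Times_iff)
  then obtain p where "p \<in> cdom c \<inter> cdom c'" "fst z = cmap c p" by blast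
  then show thesis using \<open>snd z \<noteq> 0\<close> that by blast
qed

text \<open>A nonzero fibre coordinate and a base point in the chart always come from a point of the slit
  tangent bundle, since the cocycle rule extends one component vector to a tangent vector.\<close>

lemma image_induced:
  assumes c: "c \<in> A"
  shows "cmap (induced_chart A c) ` {u \<in> cdom (induced_chart A c). fst u \<in> cdom c'} =
    overlap c c' \<times> (- {0})" (is "?L = ?R")
proof (intro equalityI subsetI)
  fix z assume "z \<in> ?L"
  then show "z \<in> ?R"
    using nonzero_component[OF c] by (force simp: cmap_induced cdom_induced)
next
  fix z assume "z \<in> ?R"
  then obtain p where p: "p \<in> cdom c" "p \<in> cdom c'" "fst z = cmap c p" "snd z \<noteq> 0"
    by (rule overlapE)
  then show "z \<in> ?L"
    using tangent_of_induced[OF c p(1,4)] by (intro image_eqI[of _ _ "(p, tangent_of c p (snd z))"])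
      (simp_all add: prod_eq_iff)
qed

lemma open_induced_overlap:
  assumes "c \<in> A" "c' \<in> A"
  shows "open (overlap c c' \<times> (- {0 :: real^2}))"
  using open_overlap[OF assms] by (intro open_Times) auto

lemma open_induced_image:
  assumes c: "c \<in> A"
  shows "open (cmap (induced_chart A c) ` cdom (induced_chart A c))"
proof -
  have "{u \<in> cdom (induced_chart A c). fst u \<in> cdom c} = cdom (induced_chart A c)"
    by (auto simp: cdom_induced)
  then show ?thesis
    using image_induced[OF c, of c] open_induced_overlap[OF c c] by simp
qed

lemma transition_induced:
  assumes c: "c \<in> A" "c' \<in> A" and z: "z \<in> overlap c c' \<times> (- {0})"
  shows "(cmap (induced_chart A c') \<circ> cinv (induced_chart A c)) z =
    (transition c c' (fst z), trD c c' (fst z) (snd z))"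
proof -
  obtain p where p: "p \<in> cdom c" "p \<in> cdom c'" "fst z = cmap c p" "snd z \<noteq> 0"
    using z by (rule overlapE)
  let ?u = "(p, tangent_of c p (snd z))"
  have "cmap (induced_chart A c) ?u = z" 
    using tangent_of_induced(2)[OF c(1) p(1,4)] p(3) by (simp add: prod_eq_iff)
  then have "cinv (induced_chart A c) z = ?u"
    using cinv_induced_cmap[OF c(1) tangent_of_induced(1)[OF c(1) p(1,4)]] by simp
  then show ?thesis
    using p(2,3) c(2) by (simp add: cmap_induced tangent_of_def cinv_cmap[OF c(1) p(1)])
qed

lemma transition_induced_has_derivative:
  assumes c: "c \<in> A" "c' \<in> A" and z: "z \<in> overlap c c' \<times> (- {0})"
  shows "((cmap (induced_chart A c') \<circ> cinv (induced_chart A c)) has_derivative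
    (\<lambda>v. (trD c c' (fst z) (fst v), trD c c' (fst z) (snd v) +
       frechet_derivative (\<lambda>x. trD c c' x (snd z)) (at (fst z)) (fst v)))) (at z)"
proof -
  let ?W = "overlap c c' \<times> (- {0 :: real^2})"
  have x: "fst z \<in> overlap c c'" using z by auto
  have d: "((\<lambda>z. trD c c' (fst z) b) has_derivative
      (\<lambda>v. frechet_derivative (\<lambda>x. trD c c' x b) (at (fst z)) (fst v))) (at z)" for b
    by (rule has_derivative_compose[OF bounded_linear_imp_has_derivative[OF bounded_linear_fst]])
      (rule smooth_on_has_derivative[OF smooth_on_frechet_derivative[OF open_overlap[OF c]
        smooth_transition[OF c] smooth_on_const] x])
  have d_snd: "((\<lambda>z. trD c c' (fst z) (snd z)) has_derivative (\<lambda>v. trD c c' (fst z) (snd v) +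
      frechet_derivative (\<lambda>z'. trD c c' (fst z') (snd z)) (at z) v)) (at z)"
    by (rule has_derivative_linear_field[OF open_induced_overlap[OF c] z])
      (auto intro!: linear_trD c bounded_linear_imp_has_derivative bounded_linear_snd
        simp del: comp_apply simp: differentiable_def intro: d)
  have "frechet_derivative (\<lambda>z'. trD c c' (fst z') (snd z)) (at z) v =
      frechet_derivative (\<lambda>x. trD c c' x (snd z)) (at (fst z)) (fst v)" for v
    by (rule fun_cong[OF frechet_derivative_at[OF d, symmetric]])
  with d_snd have "((\<lambda>z. trD c c' (fst z) (snd z)) has_derivative (\<lambda>v. trD c c' (fst z) (snd v) +
      frechet_derivative (\<lambda>x. trD c c' x (snd z)) (at (fst z)) (fst v))) (at z)"
    by simp
  moreover have "((\<lambda>z. transition c c' (fst z)) has_derivative (\<lambda>v. trD c c' (fst z) (fst v))) (at z)"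
    by (rule has_derivative_compose[OF bounded_linear_imp_has_derivative[OF bounded_linear_fst]])
      (rule transition_has_derivative[OF c x])
  ultimately have "((\<lambda>z. (transition c c' (fst z), trD c c' (fst z) (snd z))) has_derivative
    (\<lambda>v. (trD c c' (fst z) (fst v), trD c c' (fst z) (snd v) +
       frechet_derivative (\<lambda>x. trD c c' x (snd z)) (at (fst z)) (fst v)))) (at z)"
    by (rule has_derivative_Pair[rotated])
  then show ?thesis
    by (rule has_derivative_transform_within_open[OF _ open_induced_overlap[OF c] z])
      (rule transition_induced[OF c, symmetric])
qed

lemma slit_overlap:
  assumes c: "c \<in> A" "c' \<in> A" and u: "u \<in> cdom (induced_chart A c)" "u \<in> cdom (induced_chart A c')"
  shows "cmap (induced_chart A c) u \<in> overlap c c' \<times> (- {0})"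
  using image_induced[OF c(1), of c'] u by (auto simp: cdom_induced)

lemma linear_transition_slit:
  assumes "c \<in> slit_atlas A" "c' \<in> slit_atlas A" "u \<in> cdom c \<inter> cdom c'"
  shows "linear (frechet_derivative (cmap c' \<circ> cinv c) (at (cmap c u)))"
proof -
  obtain b b' where b: "b \<in> A" "b' \<in> A" "c = induced_chart A b" "c' = induced_chart A b'"
    using assms unfolding slit_atlas_def by auto
  note d = transition_induced_has_derivative[OF b(1,2) slit_overlap[OF b(1,2)]]
  show ?thesis
    using frechet_derivative_at[OF d, of u] has_derivative_linear[OF d, of u] assms(3) b(3,4) by auto
qed

lemma slit_tangent_linear_comb:
  assumes "\<xi> \<in> tangent_space (slit_atlas A) u" "\<zeta> \<in> tangent_space (slit_atlas A) u"
  shows "(\<lambda>c. s *\<^sub>R \<xi> c + t *\<^sub>R \<zeta> c) \<in> tangent_space (slit_atlas A) u"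
  by (rule tangent_space_linear_comb[OF assms linear_transition_slit])

text \<open>The coordinate change is linear in the fibre, and its base component is that of the surface.
  These two facts make the almost-tangent structure and the Liouville field independent of the chart.\<close>

lemma transition_slit_derivative:
  assumes "b \<in> A" "b' \<in> A" and u: "u \<in> cdom (induced_chart A b)" "u \<in> cdom (induced_chart A b')"
  defines "T \<equiv> frechet_derivative (cmap (induced_chart A b') \<circ> cinv (induced_chart A b)) (at (cmap (induced_chart A b) u))"
  shows "T (0, w) = (0, trD b b' (cmap b (fst u)) w)"
    and "fst (T v) = trD b b' (cmap b (fst u)) (fst v)"
proof -
  note z = slit_overlap[OF assms(1-4)]
  note d = transition_induced_has_derivative[OF assms(1,2) z]
  note T = fun_cong[OF frechet_derivative_at[OF d, symmetric], folded T_def]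
  have x: "cmap b (fst u) \<in> overlap b b'" using z by (simp add: cmap_induced)
  have sm: "smooth_on (overlap b b') (\<lambda>x. trD b b' x w)" for w
    by (rule smooth_on_frechet_derivative[OF open_overlap smooth_transition smooth_on_const])
      (use assms in auto)
  note 0 = linear_0[OF linear_trD[OF assms(1,2) x]]
    linear_0[OF linear_frechet_derivative[OF smooth_on_differentiable[OF sm x]]]
  show "T (0, w) = (0, trD b b' (cmap b (fst u)) w)"
    unfolding T using 0 by (simp add: cmap_induced)
  show "fst (T v) = trD b b' (cmap b (fst u)) (fst v)"
    unfolding T by (simp add: cmap_induced)
qed

lemma Jvec_tangent:
  assumes \<xi>: "\<xi> \<in> tangent_space (slit_atlas A) u"
  shows "Jvec \<xi> \<in> tangent_space (slit_atlas A) u"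
proof (rule tangent_spaceI)
  fix c c'
  assume c: "c \<in> slit_atlas A" "c' \<in> slit_atlas A" "u \<in> cdom c" "u \<in> cdom c'"
  show "Jvec \<xi> c' = frechet_derivative (cmap c' \<circ> cinv c) (at (cmap c u)) (Jvec \<xi> c)"
  proof -
    obtain b b' where b: "b \<in> A" "b' \<in> A" "c = induced_chart A b" "c' = induced_chart A b'"
      using c unfolding slit_atlas_def by auto
    note t = transition_slit_derivative[OF b(1,2) c(3,4)[unfolded b(3,4)], folded b(3,4)]
    show ?thesis
      using arg_cong[OF tangent_spaceD[OF \<xi> c(1,3,2,4)], of fst] by (simp add: Jvec_def t)
  qed
qed (simp add: Jvec_def zero_prod_def tangent_space_outside[OF \<xi>])

lemma Liouville_tangent: "Liouville A u \<in> tangent_space (slit_atlas A) u"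
proof (rule tangent_spaceI)
  fix c c'
  assume c: "c \<in> slit_atlas A" "c' \<in> slit_atlas A" "u \<in> cdom c" "u \<in> cdom c'"
  show "Liouville A u c' = frechet_derivative (cmap c' \<circ> cinv c) (at (cmap c u)) (Liouville A u c)"
  proof -
    obtain b b' where b: "b \<in> A" "b' \<in> A" "c = induced_chart A b" "c' = induced_chart A b'"
      using c unfolding slit_atlas_def by auto
    have "snd u \<in> tangent_space A (fst u)" "fst u \<in> cdom b" "fst u \<in> cdom b'"
      using c(3,4) unfolding b cdom_induced by (auto simp: slit_iff)
    then have "snd u b' = trD b b' (cmap b (fst u)) (snd u b)"
      using tangent_spaceD[of "snd u" A "fst u" b b'] b(1,2) by blast
    then show ?thesis
      using c transition_slit_derivative(1)[OF b(1,2) c(3,4)[unfolded b(3,4)], folded b(3,4)]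
      by (simp add: Liouville_def b cmap_induced)
  qed
qed (auto simp: Liouville_def)

end


section \<open>The connection forms\<close>

lemma lie_outside: "c \<notin> B \<or> u \<notin> cdom c \<Longrightarrow> lie B X Y u c = 0"
  by (auto simp: lie_def)

text \<open>Tangent vectors vanish off the charts around their base point. The equalities between tangent
  vectors below are equalities of functions on all charts, so the connection has to vanish there too.\<close>

lemma berwald_conn_outside:
  assumes "c \<notin> slit_atlas A \<or> u \<notin> cdom c"
  shows "berwald_conn A S X Y u c = 0"
proof -
  note l = lie_outside[OF assms]
  have J: "Jst W u c = 0" if "W u c = 0" for W
    using that by (simp add: Jst_def Jvec_def zero_prod_def)
  have n: "fn_endo_vec (slit_atlas A) Jst S W u c = 0" for W
    by (simp add: fn_endo_vec_def vsub_def l J)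
  have h: "hproj A S W u c = 0" if "W u c = 0" for W
    using that by (simp add: hproj_def vscale_def vadd_def n)
  have v: "vproj A S W u c = 0" if "W u c = 0" for W
    using that by (simp add: vproj_def vscale_def vsub_def n)
  have t: "theta A S W u c = 0" for W
    unfolding theta_def fn_vec_endo_def by (intro h) (simp add: vsub_def l h)
  show ?thesis
    by (simp add: berwald_conn_def Let_def vadd_def h v t J l)
qed

lemma coframe_linear:
  assumes "dual_coframe A E \<eta>" "i \<in> {1..4}" "u \<in> slit A"
    "\<xi> \<in> tangent_space (slit_atlas A) u" "\<zeta> \<in> tangent_space (slit_atlas A) u"
  shows "\<eta> i u (\<lambda>c. s *\<^sub>R \<xi> c + t *\<^sub>R \<zeta> c) = s * \<eta> i u \<xi> + t * \<eta> i u \<zeta>"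
  using assms unfolding dual_coframe_def one_form_def by blast

lemma coframe_frame:
  assumes "dual_coframe A (berwald_frame A S H) \<eta>" "i \<in> {1..4}" "u \<in> slit A"
  shows "\<eta> i u (H u) = of_bool (i = 1)" "\<eta> i u (S u) = of_bool (i = 2)"
    "\<eta> i u (Jst H u) = of_bool (i = 3)" "\<eta> i u (Liouville A u) = of_bool (i = 4)"
proof -
  have dual: "\<eta> i u (berwald_frame A S H j u) = (if i = j then 1 else 0)" if "j \<in> {1..4}" for j
    using assms that unfolding dual_coframe_def by blast
  show "\<eta> i u (H u) = of_bool (i = 1)" "\<eta> i u (S u) = of_bool (i = 2)"
    "\<eta> i u (Jst H u) = of_bool (i = 3)" "\<eta> i u (Liouville A u) = of_bool (i = 4)"
    using dual[of 1] dual[of 2] dual[of 3] dual[of 4] by (simp_all add: berwald_frame_def)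
qed

lemma real2_basis_span:
  fixes x y v :: "real^2"
  assumes indep: "\<And>\<alpha> \<beta>. \<alpha> *\<^sub>R x + \<beta> *\<^sub>R y = 0 \<Longrightarrow> \<alpha> = 0 \<and> \<beta> = 0"
  shows "\<exists>\<alpha> \<beta>. v = \<alpha> *\<^sub>R x + \<beta> *\<^sub>R y"
proof -
  define d where "d = x$1 * y$2 - x$2 * y$1"
  have "d \<noteq> 0"
  proof
    assume d: "d = 0"
    have "y$2 *\<^sub>R x + (- x$2) *\<^sub>R y = 0" "y$1 *\<^sub>R x + (- x$1) *\<^sub>R y = 0"
      using d by (simp_all add: vec_eq_iff forall_2 d_def algebra_simps)
    from this[THEN indep] have "x = 0" by (simp add: vec_eq_iff forall_2)
    then show False using indep[of 1 0] by simp
  qed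
  have "d *\<^sub>R v = (v$1 * y$2 - v$2 * y$1) *\<^sub>R x + (x$1 * v$2 - x$2 * v$1) *\<^sub>R y"
    by (simp add: vec_eq_iff forall_2 d_def algebra_simps)
  then have "(1 / d) *\<^sub>R (d *\<^sub>R v) = ((v$1 * y$2 - v$2 * y$1) / d) *\<^sub>R x + ((x$1 * v$2 - x$2 * v$1) / d) *\<^sub>R y"
    by (simp add: scaleR_add_right)
  then have "v = ((v$1 * y$2 - v$2 * y$1) / d) *\<^sub>R x + ((x$1 * v$2 - x$2 * v$1) / d) *\<^sub>R y"
    using \<open>d \<noteq> 0\<close> by simp
  then show ?thesis by blast
qed

context smooth_surface
begin

lemma finsler_scaling:
  assumes F: "finsler_function A F" and c: "c \<in> A"
    and z: "z \<in> cmap (induced_chart A c) ` cdom (induced_chart A c)" and t: "t > 0"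
  shows "fibre_dil t z \<in> cmap (induced_chart A c) ` cdom (induced_chart A c)"
    and "sqF F (induced_chart A c) (fibre_dil t z) = t\<^sup>2 * sqF F (induced_chart A c) z"
proof -
  obtain u where u: "u \<in> cdom (induced_chart A c)" "z = cmap (induced_chart A c) u"
    using z by blast
  let ?v = "(fst u, \<lambda>c. t *\<^sub>R snd u c)"
  have u': "snd u \<in> tangent_space A (fst u)" "snd u \<noteq> (\<lambda>_. 0)" "fst u \<in> cdom c"
    using u(1) by (simp_all add: cdom_induced slit_iff)
  have v: "?v \<in> cdom (induced_chart A c)" "cmap (induced_chart A c) ?v = fibre_dil t z"
    using tangent_dilation[OF u'(1), of t] u' t
    by (simp_all add: cdom_induced slit_iff fun_eq_iff u(2) cmap_induced fibre_dil_def)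
  then show "fibre_dil t z \<in> cmap (induced_chart A c) ` cdom (induced_chart A c)"
    by (metis imageI)
  have "u \<in> tangent_bundle A"
    using u(1) by (simp add: cdom_induced slit_def split_beta)
  then have "F ?v = t * F u"
    using F t unfolding finsler_function_def by (auto simp: split_beta)
  then show "sqF F (induced_chart A c) (fibre_dil t z) = t\<^sup>2 * sqF F (induced_chart A c) z"
    using cinv_induced_cmap[OF c v(1)] cinv_induced_cmap[OF c u(1)] u(2)
    by (simp add: sqF_def v(2) power_mult_distrib)
qed

text \<open>This lemma transfers the global hypotheses to an induced chart, where the computations of the
  previous sections apply.\<close>

lemma berwald_chart_induced:
  assumes F: "finsler_function A F" and S: "geodesic_spray A F S"
    and H: "berwald_frame_gen A F S K I H" and b: "b \<in> A"
  defines "c \<equiv> induced_chart A b"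
  shows "berwald_chart A c S F H (\<lambda>z. I (cinv c z)) (\<lambda>z. landsberg A S I (cinv c z))"
proof -
  let ?U = "cmap c ` cdom c"
  have c: "c \<in> slit_atlas A" using b by (simp add: c_def slit_atlas_def)
  have op: "open ?U" unfolding c_def by (rule open_induced_image[OF b])
  have inv: "cinv c z \<in> cdom c" "cmap c (cinv c z) = z" if "z \<in> ?U" for z
    using that unfolding cinv_def by (auto intro: inv_into_into f_inv_into_f)
  have slit: "cinv c z \<in> slit A" if "z \<in> ?U" for z
    using inv(1)[OF that] by (simp add: c_def cdom_induced)
  have rep: "chart_rep c X z = X (cinv c z) c" for X :: "'m TMfield" and z
    by (simp add: chart_rep_def)
  have spray: "fst (S u c) = snd (cmap c u)"
      "frechet_derivative (dy j (sqF F c)) (at (cmap c u)) (S u c) = dx j (sqF F c) (cmap c u)"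
    if "u \<in> cdom c" for u j
    using S c that unfolding geodesic_spray_def by blast+
  have smF: "smooth_on ?U (F \<circ> cinv c)"
    using F c unfolding finsler_function_def smooth_fun_def by blast
  have rank: "\<forall>u\<in>cdom c. rank (finsler_metric F c (cmap c u)) = 2"
    using F c unfolding finsler_function_def by blast
  have Hs: "eq_on_slit A (hproj A S H) H"
      "eq_on_slit A (lie (slit_atlas A) (Liouville A) H) H"
      "eq_on_slit A (lie (slit_atlas A) S H) (vscale (ricci_scalar F K) (Jst H))"
      "eq_on_slit A (lie (slit_atlas A) H (Jst H))
        (vadd (vadd S (vscale I H)) (vscale (landsberg A S I) (Jst H)))"
      "vector_field (slit_atlas A) H"
    using H unfolding berwald_frame_gen_def Let_def by blast+
  show ?thesis
  proof unfold_locales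
    show "c \<in> slit_atlas A" "open ?U" by fact+
    show "inj_on (cmap c) (cdom c)" unfolding c_def by (rule inj_induced[OF b])
    show "smooth_on ?U (chart_rep c S)"
      using S c unfolding geodesic_spray_def vector_field_def chart_rep_def by blast
    show "smooth_on ?U (chart_rep c H)"
      using Hs(5) c unfolding vector_field_def chart_rep_def by blast
    show "smooth_on ?U (sqF F c)"
      using smooth_on_mult[OF op smF smF] unfolding sqF_def power2_eq_square comp_def .
  next
    fix z assume z: "z \<in> ?U"
    note i = inv[OF z] and s = slit[OF z]
    show "fst (chart_rep c S z) = snd z" using spray(1)[OF i(1)] i(2) by (simp add: rep)
    show "rank (finsler_metric F c z) = 2"
      using rank i by force
    show "frechet_derivative (dy j (sqF F c)) (at z) (chart_rep c S z) = dx j (sqF F c) z" for j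
      using spray(2)[OF i(1)] i(2) by (simp add: rep)
    show "chart_rep c (hproj A S H) z = chart_rep c H z"
      "chart_rep c (lie (slit_atlas A) (Liouville A) H) z = chart_rep c H z"
      using Hs(1,2) s by (simp_all add: eq_on_slit_def rep)
    show "fst (chart_rep c (lie (slit_atlas A) S H) z) = 0"
      using Hs(3) s by (simp add: eq_on_slit_def rep vscale_def Jst_def Jvec_def)
    show "chart_rep c (lie (slit_atlas A) H (Jst H)) z = chart_rep c S z +
      I (cinv c z) *\<^sub>R chart_rep c H z + landsberg A S I (cinv c z) *\<^sub>R chart_rep c (Jst H) z"
      using Hs(4) s by (simp add: eq_on_slit_def rep vscale_def vadd_def)
    fix t :: real assume t: "0 < t"
    show "fibre_dil t z \<in> ?U" "sqF F c (fibre_dil t z) = t\<^sup>2 * sqF F c z"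
      using finsler_scaling[OF F b _ t] z unfolding c_def by blast+
  qed
qed

lemma exists_slit_chart: "u \<in> slit A \<Longrightarrow> \<exists>b\<in>A. u \<in> cdom (induced_chart A b)"
  using exists_chart[of "fst u"] by (auto simp: cdom_induced)

lemma frame_tangent:
  assumes S: "geodesic_spray A F S" and H: "berwald_frame_gen A F S K I H" and u: "u \<in> slit A"
  shows "H u \<in> tangent_space (slit_atlas A) u" "S u \<in> tangent_space (slit_atlas A) u"
    "Jst H u \<in> tangent_space (slit_atlas A) u" "Liouville A u \<in> tangent_space (slit_atlas A) u"
proof -
  have "u \<in> (\<Union>c\<in>slit_atlas A. cdom c)"
    using exists_slit_chart[OF u] by (auto simp: slit_atlas_def)
  then show Hu: "H u \<in> tangent_space (slit_atlas A) u" and "S u \<in> tangent_space (slit_atlas A) u"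
    using H S unfolding berwald_frame_gen_def geodesic_spray_def vector_field_def Let_def by blast+
  show "Jst H u \<in> tangent_space (slit_atlas A) u"
    using Jvec_tangent[OF Hu] by (simp add: Jst_def)
qed (rule Liouville_tangent)

text \<open>A relation between \<open>V\<close> and \<open>C\<close> is killed by \<open>\<eta>\<^sup>3\<close> and \<open>\<eta>\<^sup>4\<close>, so \<open>a\<close> and \<open>y\<close>
  form a basis of \<open>\<real>\<^sup>2\<close>. Expanding the base component and the vertical part of a tangent vector
  in this basis gives its coefficients with respect to \<open>H, S\<close> and to \<open>V, C\<close>.\<close>

lemma coframe_expansion:
  assumes F: "finsler_function A F" and S: "geodesic_spray A F S"
    and H: "berwald_frame_gen A F S K I H"
    and dual: "dual_coframe A (berwald_frame A S H) \<eta>"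
    and u: "u \<in> slit A" and \<xi>: "\<xi> \<in> tangent_space (slit_atlas A) u"
  shows "\<xi> = (\<lambda>c. \<eta> 1 u \<xi> *\<^sub>R H u c + \<eta> 2 u \<xi> *\<^sub>R S u c
      + \<eta> 3 u \<xi> *\<^sub>R Jst H u c + \<eta> 4 u \<xi> *\<^sub>R Liouville A u c)"
proof -
  let ?T = "tangent_space (slit_atlas A) u" and ?V = "Jst H" and ?C = "Liouville A"
  obtain b where b: "b \<in> A" "u \<in> cdom (induced_chart A b)" using exists_slit_chart[OF u] by blast
  define c where "c = induced_chart A b"
  interpret berwald_chart A c S F H "\<lambda>z. I (cinv c z)" "\<lambda>z. landsberg A S I (cinv c z)"
    unfolding c_def by (rule berwald_chart_induced[OF F S H b(1)])
  have uc: "u \<in> cdom c" using b by (simp add: c_def)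
  define z where "z = cmap c u"
  have z: "z \<in> U" using uc by (simp add: z_def)
  have rep: "rep X z = X u c" for X
    using cinv_induced_cmap[OF b] by (simp add: chart_rep_def z_def c_def)
  note Hu = frame_tangent(1)[OF S H u] and Su = frame_tangent(2)[OF S H u]
    and Vu = frame_tangent(3)[OF S H u] and Cu = frame_tangent(4)[OF S H u]
  note lin = coframe_linear[OF dual _ u] and \<eta> = coframe_frame[OF dual _ u]
  have "\<alpha> = 0 \<and> \<beta> = 0" if "\<alpha> *\<^sub>R a z + \<beta> *\<^sub>R snd z = 0" for \<alpha> \<beta>
  proof -
    have "(\<lambda>c. \<alpha> *\<^sub>R ?V u c + \<beta> *\<^sub>R ?C u c) = (\<lambda>c. 0 *\<^sub>R ?V u c + 0 *\<^sub>R ?C u c)"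
      by (rule tangent_space_eqI[OF slit_tangent_linear_comb[OF Vu Cu]
          slit_tangent_linear_comb[OF Vu Cu] chart uc])
        (use that in \<open>simp_all add: rep[symmetric] rep_V rep_C[OF z] zero_prod_def\<close>)
    then have "\<alpha> * \<eta> i u (?V u) + \<beta> * \<eta> i u (?C u) = 0" if "i \<in> {1..4}" for i
      using lin[OF that Vu Cu, of \<alpha> \<beta>] lin[OF that Vu Cu, of 0 0] by simp
    from this[of 3] this[of 4] show ?thesis by (simp add: \<eta>)
  qed
  note span = real2_basis_span[of "a z" "snd z", OF this]
  obtain e1 e2 where e12: "fst (\<xi> c) = e1 *\<^sub>R a z + e2 *\<^sub>R snd z" using span by blast
  obtain e3 e4 where e34: "snd (\<xi> c) - N z (fst (\<xi> c)) = e3 *\<^sub>R a z + e4 *\<^sub>R snd z"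
    using span by blast
  define h where "h = (\<lambda>c. e1 *\<^sub>R H u c + e2 *\<^sub>R S u c)"
  define v where "v = (\<lambda>c. e3 *\<^sub>R ?V u c + e4 *\<^sub>R ?C u c)"
  have hT: "h \<in> ?T" and vT: "v \<in> ?T"
    unfolding h_def v_def
    by (rule slit_tangent_linear_comb[OF Hu Su]) (rule slit_tangent_linear_comb[OF Vu Cu])
  have "snd (\<xi> c) = N z (fst (\<xi> c)) + (e3 *\<^sub>R a z + e4 *\<^sub>R snd z)" using e34 by (simp add: algebra_simps)
  then have "\<xi> c = 1 *\<^sub>R h c + 1 *\<^sub>R v c"
    by (intro prod_eqI) (simp_all add: h_def v_def rep[symmetric] rep_V rep_C[OF z] rep_S[OF z]
        snd_H[OF z] e12 linear_add[OF linear_N[OF z]] linear_cmul[OF linear_N[OF z]])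
  then have eq: "\<xi> = (\<lambda>c. 1 *\<^sub>R h c + 1 *\<^sub>R v c)"
    by (intro tangent_space_eqI[OF \<xi> slit_tangent_linear_comb[OF hT vT] chart uc])
  have "\<eta> i u \<xi> = e1 * of_bool (i = 1) + e2 * of_bool (i = 2) + (e3 * of_bool (i = 3) + e4 * of_bool (i = 4))"
    if i: "i \<in> {1..4}" for i
    unfolding eq lin[OF i hT vT] unfolding h_def v_def lin[OF i Hu Su] lin[OF i Vu Cu] \<eta>[OF i] by simp
  from this[of 1] this[of 2] this[of 3] this[of 4]
  have "\<eta> 1 u \<xi> = e1" "\<eta> 2 u \<xi> = e2" "\<eta> 3 u \<xi> = e3" "\<eta> 4 u \<xi> = e4" by simp_all
  then show ?thesis
    by (subst eq) (simp add: h_def v_def add.assoc)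
qed

lemma berwald_conn_frame:
  assumes F: "finsler_function A F" and S: "geodesic_spray A F S"
    and H: "berwald_frame_gen A F S K I H"
    and dual: "dual_coframe A (berwald_frame A S H) \<eta>"
    and X: "vector_field (slit_atlas A) X" and u: "u \<in> slit A"
  defines "k \<equiv> landsberg A S I u * \<eta> 1 u (X u) - I u * \<eta> 3 u (X u) + \<eta> 4 u (X u)"
  shows "berwald_conn A S X H u = (\<lambda>c. k *\<^sub>R H u c + (- \<eta> 3 u (X u)) *\<^sub>R S u c)"
    and "berwald_conn A S X S u = (\<lambda>c. \<eta> 3 u (X u) *\<^sub>R H u c + \<eta> 4 u (X u) *\<^sub>R S u c)"
    and "berwald_conn A S X (Jst H) u = (\<lambda>c. k *\<^sub>R Jst H u c + (- \<eta> 3 u (X u)) *\<^sub>R Liouville A u c)"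
    and "berwald_conn A S X (Liouville A) u =
      (\<lambda>c. \<eta> 3 u (X u) *\<^sub>R Jst H u c + \<eta> 4 u (X u) *\<^sub>R Liouville A u c)"
proof -
  let ?D = "berwald_conn A S X"
  have "u \<in> (\<Union>c\<in>slit_atlas A. cdom c)"
    using exists_slit_chart[OF u] by (auto simp: slit_atlas_def)
  then have T: "X u \<in> tangent_space (slit_atlas A) u" using X unfolding vector_field_def by blast
  have "?D H u c = k *\<^sub>R H u c + (- \<eta> 3 u (X u)) *\<^sub>R S u c \<and>
    ?D S u c = \<eta> 3 u (X u) *\<^sub>R H u c + \<eta> 4 u (X u) *\<^sub>R S u c \<and>
    ?D (Jst H) u c = k *\<^sub>R Jst H u c + (- \<eta> 3 u (X u)) *\<^sub>R Liouville A u c \<and>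
    ?D (Liouville A) u c = \<eta> 3 u (X u) *\<^sub>R Jst H u c + \<eta> 4 u (X u) *\<^sub>R Liouville A u c" for c
  proof (cases "c \<in> slit_atlas A \<and> u \<in> cdom c")
    case True
    then obtain b where b: "b \<in> A" "c = induced_chart A b" by (auto simp: slit_atlas_def)
    interpret berwald_chart A c S F H "\<lambda>z. I (cinv c z)" "\<lambda>z. landsberg A S I (cinv c z)"
      unfolding b(2) by (rule berwald_chart_induced[OF F S H b(1)])
    have z: "cmap c u \<in> U" using True by blast
    have inv: "cinv c (cmap c u) = u" using cinv_induced_cmap[OF b(1)] True b(2) by simp
    have rep: "rep Y (cmap c u) = Y u c" for Y
      by (simp add: chart_rep_def inv)
    have sX: "smooth_rep X" using X chart unfolding vector_field_def chart_rep_def by blast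
    have "rep X (cmap c u) = \<eta> 1 u (X u) *\<^sub>R rep H (cmap c u) + \<eta> 2 u (X u) *\<^sub>R rep S (cmap c u)
        + \<eta> 3 u (X u) *\<^sub>R rep (Jst H) (cmap c u) + \<eta> 4 u (X u) *\<^sub>R rep (Liouville A) (cmap c u)"
      unfolding rep by (rule fun_cong[OF coframe_expansion[OF F S H dual u T]])
    note D = rep_berwald_conn_frame[OF z sX this]
    show ?thesis using D unfolding rep inv k_def by simp
  next
    case False
    then have F: "c \<notin> slit_atlas A \<or> u \<notin> cdom c" by blast
    show ?thesis
      using frame_tangent[OF S H u, THEN tangent_space_outside, OF F]
      by (simp add: berwald_conn_outside[OF F])
  qed
  then show "?D H u = (\<lambda>c. k *\<^sub>R H u c + (- \<eta> 3 u (X u)) *\<^sub>R S u c)"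
    "?D S u = (\<lambda>c. \<eta> 3 u (X u) *\<^sub>R H u c + \<eta> 4 u (X u) *\<^sub>R S u c)"
    "?D (Jst H) u = (\<lambda>c. k *\<^sub>R Jst H u c + (- \<eta> 3 u (X u)) *\<^sub>R Liouville A u c)"
    "?D (Liouville A) u = (\<lambda>c. \<eta> 3 u (X u) *\<^sub>R Jst H u c + \<eta> 4 u (X u) *\<^sub>R Liouville A u c)"
    by (simp_all add: fun_eq_iff)
qed

end

theorem proposition3p11:
  fixes A :: "('m::{t2_space,second_countable_topology}, real^2) chart set"
    and F K I :: "'m TM \<Rightarrow> real"
    and S H :: "'m TMfield"
    and \<eta> :: "nat \<Rightarrow> 'm TM \<Rightarrow> 'm TTM \<Rightarrow> real"
  assumes "smooth_manifold A"
    and "finsler_function A F"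
    and "geodesic_spray A F S"
    and "flag_curvature A F S K"
    and "nonflat A K"
    and "berwald_frame_gen A F S K I H"
    and "dual_coframe A (berwald_frame A S H) \<eta>"
  shows "\<forall>X. vector_field (slit_atlas A) X \<longrightarrow> (\<forall>u\<in>slit A. \<forall>a\<in>{1..4}. \<forall>b\<in>{1..4}.
    (let e = (\<lambda>i. \<eta> i u (X u)); J = landsberg A S I u in
      conn_form A S (berwald_frame A S H) \<eta> a b X u =
        [[J * e 1 - I u * e 3 + e 4,  - e 3, 0,                            0],
         [e 3,                        e 4,   0,                            0],
         [0,                          0,     J * e 1 - I u * e 3 + e 4,    - e 3],
         [0,                          0,     e 3,                          e 4]]
        ! (b - 1) ! (a - 1)))"
proof -
  interpret smooth_surface A by unfold_locales fact
  show ?thesis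
  proof (intro allI impI ballI)
    fix X u and a b :: nat
    assume X: "vector_field (slit_atlas A) X" and u: "u \<in> slit A"
      and a: "a \<in> {1..4}" and b: "b \<in> {1..4}"
    note D = berwald_conn_frame[OF assms(2,3,6,7) X u]
    note Hu = frame_tangent(1)[OF assms(3,6) u] and Su = frame_tangent(2)[OF assms(3,6) u]
      and Vu = frame_tangent(3)[OF assms(3,6) u] and Cu = frame_tangent(4)[OF assms(3,6) u]
    note lin = coframe_linear[OF assms(7) a u] and \<eta> = coframe_frame[OF assms(7) a u]
    have conn: "\<eta> a u (berwald_conn A S X H u) =
        (landsberg A S I u * \<eta> 1 u (X u) - I u * \<eta> 3 u (X u) + \<eta> 4 u (X u)) * of_bool (a = 1)
        + (- \<eta> 3 u (X u)) * of_bool (a = 2)"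
      "\<eta> a u (berwald_conn A S X S u) =
        \<eta> 3 u (X u) * of_bool (a = 1) + \<eta> 4 u (X u) * of_bool (a = 2)"
      "\<eta> a u (berwald_conn A S X (Jst H) u) =
        (landsberg A S I u * \<eta> 1 u (X u) - I u * \<eta> 3 u (X u) + \<eta> 4 u (X u)) * of_bool (a = 3)
        + (- \<eta> 3 u (X u)) * of_bool (a = 4)"
      "\<eta> a u (berwald_conn A S X (Liouville A) u) =
        \<eta> 3 u (X u) * of_bool (a = 3) + \<eta> 4 u (X u) * of_bool (a = 4)"
      unfolding D lin[OF Hu Su] lin[OF Vu Cu] \<eta> by (rule refl)+
    have "a = 1 \<or> a = 2 \<or> a = 3 \<or> a = 4" "b = 1 \<or> b = 2 \<or> b = 3 \<or> b = 4"
      using a b by auto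
    with conn show "let e = (\<lambda>i. \<eta> i u (X u)); J = landsberg A S I u in
      conn_form A S (berwald_frame A S H) \<eta> a b X u =
        [[J * e 1 - I u * e 3 + e 4,  - e 3, 0,                            0],
         [e 3,                        e 4,   0,                            0],
         [0,                          0,     J * e 1 - I u * e 3 + e 4,    - e 3],
         [0,                          0,     e 3,                          e 4]]
        ! (b - 1) ! (a - 1)"
      unfolding Let_def conn_form_def
      by (elim disjE) (simp_all add: berwald_frame_def)
  qed
qed

end
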